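(* Let $k\geq 0$ be an integer and let $\ell$ be a prime with $\ell\equiv 3 \pmod{5}$. Then for every nonnegative integer $n$ with $\left(\frac{-n}{\ell}\right)=-1$, \[ \overline{p}(4^k\cdot 5\ell^2 n)\equiv 0 \pmod{5}. \]
   Context: An overpartition of a nonnegative integer $n$ is a partition of $n$ in which the first occurrence of each distinct part may be overlined. $\overline{p}(n)$ denotes the number of overpartitions of $n$, with $\overline{p}(0)=1$; equivalently $\sum_{n\ge0}\overline{p}(n)q^n=\prod_{k\ge1}\frac{1+q^k}{1-q^k}$. $\left(\frac{\cdot}{\ell}\right)$ is the Legendre symbol. *)

theory Defs
  imports "HOL-Computational_Algebra.Formal_Power_Series" "HOL-Number_Theory.Number_Theory"
begin

text \<open>Generating function of overpartitions truncated at factors k \<le> N: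
  prod_{k=1}^{N} (1 + q^k) / (1 - q^k), as a formal power series over int,
  where 1/(1 - q^k) = sum_j q^(k j) is written out as geom_fps k.
  Factors with k > n do not affect the coefficient of q^n.\<close>

definition geom_fps :: "nat \<Rightarrow> int fps" where
  "geom_fps k = Abs_fps (\<lambda>j. if k dvd j then 1 else 0)"

definition overpart_gf :: "nat \<Rightarrow> int fps" where
  "overpart_gf N = (\<Prod>k\<in>{1..N}. (1 + fps_X ^ k) * geom_fps k)"

definition overpartition_count :: "nat \<Rightarrow> int" where
  "overpartition_count n = fps_nth (overpart_gf n) n"

end

theory Submission
  imports Defs
begin

text \<open>
  Write \<open>\<theta> = \<Sum>\<^sub>j (-1)\<^sup>j q^j\<^sup>2\<close> (over all integers \<open>j\<close>) and let \<open>r\<^sub>m(n)\<close> count the representations of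
  \<open>n\<close> as a sum of \<open>m\<close> squares. By Gauss, \<open>\<theta>\<close> is the inverse of the overpartition series \<open>P\<close>.
  Modulo 5, \<open>P \<theta>(q\<^sup>5) = P \<theta>\<^sup>5 = \<theta>\<^sup>4\<close>; comparing coefficients of \<open>q\<^sup>5\<^sup>n\<close> and using
  \<open>r\<^sub>4(5n) = r\<^sub>4(n)\<close> modulo 5 gives \<open>p(5n) = (-1)\<^sup>n r\<^sub>3(n)\<close> modulo 5. It remains to see that
  \<open>r\<^sub>3(4n) = r\<^sub>3(n)\<close> and that \<open>r\<^sub>3(\<ell>\<^sup>2 n) = (\<ell> + 2) r\<^sub>3(n)\<close> when \<open>-n\<close> is a quadratic non-residue modulo the
  odd prime \<open>\<ell>\<close>.

  Both recursions are double counts of integral quaternions \<open>a\<close> of norm \<open>\<ell>\<close>: one counts products \<open>a b\<close>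
  for \<open>r\<^sub>4\<close>, and conjugates \<open>a v a'\<close> of pure quaternions \<open>v\<close> of norm \<open>n\<close> for \<open>r\<^sub>3\<close>. A quaternion \<open>w\<close> that is not
  divisible by \<open>\<ell>\<close> and whose norm is, has exactly eight left divisors of norm \<open>\<ell>\<close>, because the right
  ideal generated by \<open>w\<close> and \<open>\<ell>\<close> is principal. A multiple \<open>\<ell> u\<close> of \<open>\<ell>\<close> is never a conjugate: modulo \<open>\<ell>\<close>, \<open>u\<close>
  would have an eigenvalue, a square root of \<open>-n\<close>.
\<close>

section \<open>Gauss's identity\<close>

lemma geom_fps_mult:
  assumes "k > 0"
  shows "(1 - fps_X ^ k) * geom_fps k = 1"
proof (rule fps_ext)
  fix n
  show "fps_nth ((1 - fps_X ^ k) * geom_fps k) n = fps_nth 1 n"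
    using assms by (auto simp: left_diff_distrib fps_X_power_mult_nth geom_fps_def dvd_minus_self)
qed

text \<open>From 1 - q^(2k) = (1 - q^k)(1 + q^k). Multiplied over k, it absorbs the factors 1 + q^k
  of overlined parts into even denominators.\<close>

lemma geom_fps_eq_double:
  assumes "k > 0"
  shows "geom_fps k = (1 + fps_X ^ k) * geom_fps (2 * k)"
proof -
  have "1 - fps_X ^ (2 * k) = (1 - fps_X ^ k) * (1 + fps_X ^ k :: int fps)"
    by (simp only: mult_2 power_add) (simp add: algebra_simps)
  hence "(1 - fps_X ^ k) * ((1 + fps_X ^ k) * geom_fps (2 * k)) = 1"
    using geom_fps_mult[of "2 * k"] assms by (simp add: mult.assoc)
  hence "geom_fps k = geom_fps k * ((1 - fps_X ^ k) * ((1 + fps_X ^ k) * geom_fps (2 * k)))"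
    by simp
  also have "\<dots> = ((1 - fps_X ^ k) * geom_fps k) * ((1 + fps_X ^ k) * geom_fps (2 * k))"
    by (simp only: mult_ac)
  finally show ?thesis by (simp only: geom_fps_mult[OF assms] mult_1)
qed

text \<open>The reciprocal of (q)_m = (1 - q) ... (1 - q^m).\<close>

definition inv_qfact :: "nat \<Rightarrow> int fps" where
  "inv_qfact m = (\<Prod>k\<in>{1..m}. geom_fps k)"

lemma inv_qfact_0 [simp]: "inv_qfact 0 = 1"
  by (simp add: inv_qfact_def)

lemma inv_qfact_Suc: "inv_qfact (Suc m) = geom_fps (Suc m) * inv_qfact m"
  by (simp add: inv_qfact_def)

lemma inv_qfact_pred: "(1 - fps_X ^ Suc m) * inv_qfact (Suc m) = inv_qfact m"
  using geom_fps_mult[of "Suc m"] by (simp only: inv_qfact_Suc mult.assoc [symmetric]) simp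

text \<open>The summands of \<open>\<Sum>\<bar>j\<bar>\<le>n. (-1)\<^sup>j q^j\<^sup>2 / ((q)\<^sub>n\<^sub>-\<^sub>j (q)\<^sub>n\<^sub>+\<^sub>j)\<close>, a finite form of Gauss's identity whose
  value is \<open>1 / (q\<^sup>2; q\<^sup>2)\<^sub>n\<close>. The function \<open>gauss_cert\<close> is its telescoping certificate.\<close>

definition gauss_term :: "nat \<Rightarrow> nat \<Rightarrow> int fps" where
  "gauss_term n j = (- 1) ^ j * fps_X ^ (j ^ 2) * (inv_qfact (n - j) * inv_qfact (n + j))"

definition gauss_cert :: "nat \<Rightarrow> nat \<Rightarrow> int fps" where
  "gauss_cert n j = (- 1) ^ j * fps_X ^ (j ^ 2 + (n - j)) * (inv_qfact (n - j) * inv_qfact (n + j - 1))"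

text \<open>The summands for j and -j coincide, hence the factor 2; the first term is the summand j
  = 0.\<close>

definition gauss_sum :: "nat \<Rightarrow> int fps" where
  "gauss_sum n = inv_qfact n ^ 2 + 2 * (\<Sum>j\<in>{1..n}. gauss_term n j)"

text \<open>With x = q^(n-j) and y = q^(n+j), and the common factor c a b removed, this is (1 - xy)
  - (1 - x)(1 - y) = x(1 - y) + y(1 - x). The second certificate carries the sign (-1)^(j+1), which
  makes its term positive on the right.\<close>

lemma gauss_telescope:
  assumes "1 \<le> j" "j < n"
  shows "(1 - fps_X ^ (2 * n)) * gauss_term n j - gauss_term (n - 1) j = gauss_cert n j - gauss_cert n (Suc j)"
proof -
  define d where "d = n - j - 1"
  have n: "n = Suc (j + d)" using assms by (simp add: d_def)
  define a where "a = inv_qfact (Suc d)"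
  define b where "b = inv_qfact (Suc (2 * j + d))"
  define x where "x = (fps_X :: int fps) ^ (Suc d)"
  define y where "y = (fps_X :: int fps) ^ (Suc (2 * j + d))"
  define c where "c = (- 1) ^ j * (fps_X :: int fps) ^ (j ^ 2)"
  have a': "inv_qfact d = (1 - x) * a" and b': "inv_qfact (2 * j + d) = (1 - y) * b"
    using inv_qfact_pred[of d] inv_qfact_pred[of "2 * j + d"] by (simp_all add: a_def b_def x_def y_def)
  have "fps_X ^ (2 * n) = x * y" by (simp add: n x_def y_def flip: power_add)
  moreover have "gauss_term n j = c * (a * b)"
    by (simp add: gauss_term_def n c_def a_def b_def mult_2 add_ac Suc_diff_le)
  moreover have "gauss_term (n - 1) j = c * ((1 - x) * a * ((1 - y) * b))"
    using assms by (simp add: gauss_term_def n c_def a' [symmetric] b' [symmetric] mult_2 add_ac)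
  moreover have "gauss_cert n j = c * x * (a * ((1 - y) * b))"
    by (simp add: gauss_cert_def n c_def x_def a_def b' [symmetric] mult_2 add_ac Suc_diff_le power_add)
  moreover have "gauss_cert n (Suc j) = - (c * y * ((1 - x) * a * b))"
  proof -
    have "(Suc j)\<^sup>2 + (n - Suc j) = j ^ 2 + Suc (2 * j + d)"
      and "n - Suc j = d" and "n + Suc j - 1 = Suc (2 * j + d)"
      by (simp_all add: n power2_eq_square)
    hence "gauss_cert n (Suc j) = (- 1) ^ Suc j * fps_X ^ (j ^ 2 + Suc (2 * j + d)) * ((1 - x) * a * b)"
      by (simp only: gauss_cert_def a' b_def)
    thus ?thesis by (simp only: c_def y_def power_add) simp
  qed
  ultimately show ?thesis by (simp only:) (simp add: algebra_simps)
qed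

text \<open>Summing the telescoping relation over 1..n leaves two certificate values. Doubled, one
  cancels against the summand j = 0, the other against the summand j = n + 1, which has no partner
  in \<open>gauss_sum n\<close>.\<close>

lemma gauss_sum_rec: "(1 - fps_X ^ (2 * Suc n)) * gauss_sum (Suc n) = gauss_sum n"
proof -
  let ?q = "1 - fps_X ^ (2 * Suc n) :: int fps"
  let ?A = "gauss_cert (Suc n)"
  have mid: "(\<Sum>j\<in>{1..n}. ?q * gauss_term (Suc n) j) - (\<Sum>j\<in>{1..n}. gauss_term n j) = ?A 1 - ?A (Suc n)"
  proof -
    have "(\<Sum>j\<in>{1..n}. ?q * gauss_term (Suc n) j) - (\<Sum>j\<in>{1..n}. gauss_term n j)
        = (\<Sum>j\<in>{1..n}. ?A j - ?A (Suc j))"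
      unfolding sum_subtractf [symmetric]
      using gauss_telescope[of _ "Suc n"] by (intro sum.cong) simp_all
    also have "\<dots> = ?A 1 - ?A (Suc n)"
      using sum_Suc_diff[of 1 n "\<lambda>j. - ?A j"] by (simp add: sum_negf)
    finally show ?thesis .
  qed
  have last: "?q * gauss_term (Suc n) (Suc n) = ?A (Suc n)"
  proof -
    have "?q * inv_qfact (Suc n + Suc n) = inv_qfact (Suc n + Suc n - 1)"
      using inv_qfact_pred[of "Suc (2 * n)"] by (simp add: mult_2)
    hence "(- 1) ^ Suc n * fps_X ^ ((Suc n) ^ 2) * (?q * inv_qfact (Suc n + Suc n))
      = (- 1) ^ Suc n * fps_X ^ ((Suc n) ^ 2) * inv_qfact (Suc n + Suc n - 1)"
      by (simp only:)
    thus ?thesis unfolding gauss_term_def gauss_cert_def by (simp add: mult_ac)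
  qed
  \<comment> \<open>With x = q^(n+1) and \<open>inv_qfact (Suc n) ^ 2\<close> factored out, this is
    (1 - x^2) - (1 - x)^2 = 2x(1 - x).\<close>
  have first: "?q * inv_qfact (Suc n) ^ 2 - inv_qfact n ^ 2 = - 2 * ?A 1"
  proof -
    define x where "x = (fps_X :: int fps) ^ Suc n"
    have "?q = 1 - x * x" by (simp add: x_def mult_2 flip: power_add)
    moreover have "inv_qfact n = (1 - x) * inv_qfact (Suc n)"
      unfolding x_def by (rule inv_qfact_pred [symmetric])
    moreover have "?A 1 = - (x * (inv_qfact n * inv_qfact (Suc n)))"
      by (simp add: gauss_cert_def x_def)
    ultimately show ?thesis by (simp only: power2_eq_square) (simp add: algebra_simps)
  qed
  have "?q * gauss_sum (Suc n) = ?q * inv_qfact (Suc n) ^ 2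
      + 2 * ((\<Sum>j\<in>{1..n}. ?q * gauss_term (Suc n) j) + ?q * gauss_term (Suc n) (Suc n))"
  proof -
    have "gauss_sum (Suc n) = inv_qfact (Suc n) ^ 2
        + 2 * ((\<Sum>j\<in>{1..n}. gauss_term (Suc n) j) + gauss_term (Suc n) (Suc n))"
      by (simp add: gauss_sum_def)
    moreover have "q * (a + 2 * (b + c)) = q * a + 2 * (q * b + q * c)" for q a b c :: "int fps"
      by (simp add: algebra_simps)
    ultimately show ?thesis by (simp only: sum_distrib_left)
  qed
  also have "\<dots> = inv_qfact n ^ 2 - 2 * ?A 1 + 2 * ((\<Sum>j\<in>{1..n}. gauss_term n j) + (?A 1 - ?A (Suc n)) + ?A (Suc n))"
    using mid first last by (simp only: last) (simp add: algebra_simps)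
  also have "\<dots> = gauss_sum n" by (simp add: gauss_sum_def algebra_simps)
  finally show ?thesis .
qed

lemma gauss_sum_eq: "gauss_sum n = (\<Prod>k\<in>{1..n}. geom_fps (2 * k))"
proof (induction n)
  case (Suc n)
  have "((1 - fps_X ^ (2 * Suc n)) * geom_fps (2 * Suc n)) * gauss_sum (Suc n)
      = geom_fps (2 * Suc n) * ((1 - fps_X ^ (2 * Suc n)) * gauss_sum (Suc n))"
    by (simp only: mult_ac)
  also have "(1 - fps_X ^ (2 * Suc n)) * geom_fps (2 * Suc n) = 1"
    by (rule geom_fps_mult) simp
  finally show ?case by (simp only: gauss_sum_rec Suc.IH) (simp add: mult.commute)
qed (simp add: gauss_sum_def)

section \<open>From the finite form of Gauss's identity to the infinite one, modulo q^(N+1)\<close>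

definition agree_upto :: "nat \<Rightarrow> 'a fps \<Rightarrow> 'a fps \<Rightarrow> bool" where
  "agree_upto N f g \<longleftrightarrow> (\<forall>i\<le>N. fps_nth f i = fps_nth g i)"

lemma agree_upto_refl [simp]: "agree_upto N f f"
  by (simp add: agree_upto_def)

lemma agree_upto_sym: "agree_upto N f g \<Longrightarrow> agree_upto N g f"
  by (simp add: agree_upto_def)

lemma agree_upto_trans: "agree_upto N f g \<Longrightarrow> agree_upto N g h \<Longrightarrow> agree_upto N f h"
  by (simp add: agree_upto_def)

lemma agree_upto_add:
  fixes f g :: "'a::monoid_add fps"
  shows "agree_upto N f g \<Longrightarrow> agree_upto N f' g' \<Longrightarrow> agree_upto N (f + f') (g + g')"
  by (simp add: agree_upto_def)

lemma agree_upto_mult: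
  fixes f g :: "'a::semiring_0 fps"
  shows "agree_upto N f g \<Longrightarrow> agree_upto N f' g' \<Longrightarrow> agree_upto N (f * f') (g * g')"
  by (auto simp: agree_upto_def fps_mult_nth intro!: sum.cong)

lemma agree_upto_sum:
  fixes f g :: "'b \<Rightarrow> 'a::comm_monoid_add fps"
  shows "(\<And>x. x \<in> A \<Longrightarrow> agree_upto N (f x) (g x)) \<Longrightarrow> agree_upto N (sum f A) (sum g A)"
  by (auto simp: agree_upto_def fps_sum_nth intro!: sum.cong)

lemma agree_upto_prod_tail:
  fixes f :: "nat \<Rightarrow> 'a::comm_semiring_1 fps"
  assumes "N \<le> m" "\<And>k. N < k \<Longrightarrow> agree_upto N (f k) 1"
  shows "agree_upto N (\<Prod>k\<in>{1..m}. f k) (\<Prod>k\<in>{1..N}. f k)"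
  using assms(1)
proof (induction m rule: dec_induct)
  case (step m)
  have "agree_upto N (f (Suc m) * (\<Prod>k\<in>{1..m}. f k)) (1 * (\<Prod>k\<in>{1..N}. f k))"
    using step by (intro agree_upto_mult assms(2)) auto
  thus ?case by (simp add: mult.commute)
qed simp

lemma agree_upto_geom_fps: "N < k \<Longrightarrow> agree_upto N (geom_fps k) 1"
  by (auto simp: agree_upto_def geom_fps_def dest: dvd_imp_le)

lemma agree_upto_X_power: "N < k \<Longrightarrow> agree_upto N (fps_X ^ k :: 'a::comm_ring_1 fps) 0"
  by (auto simp: agree_upto_def fps_X_power_nth)

text \<open>The signs come from Gauss's identity for \<open>\<Sum>\<^sub>j (-1)\<^sup>j q^j\<^sup>2\<close>, where \<open>(-1)\<^sup>j = (-1)^j\<^sup>2\<close>.\<close>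

definition theta :: "('a \<Rightarrow> nat) \<Rightarrow> int fps" where
  "theta u = Abs_fps (\<lambda>n. (- 1) ^ n * int (card {x. u x = n}))"

abbreviation int_square :: "int \<Rightarrow> nat" where
  "int_square x \<equiv> nat \<bar>x\<bar> ^ 2"

lemma card_int_square:
  "card {x. int_square x = n} = (if n = 0 then 1 else if \<exists>j. n = j ^ 2 then 2 else 0)"
proof -
  show ?thesis
  proof (cases "\<exists>j. n = j ^ 2")
    case True
    then obtain j where j: "n = j ^ 2" by blast
    have "{x. int_square x = n} = {int j, - int j}"
      using j by (auto simp: abs_if split: if_splits)
    thus ?thesis using j by (cases "j = 0") (auto simp: card_insert_if)
  next
    case False
    hence "{x. int_square x = n} = {}" by blast
    moreover have "n \<noteq> 0" using False by (metis zero_power2)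
    ultimately show ?thesis using False by simp
  qed
qed

lemma theta_int_square_agree:
  assumes "N \<le> m"
  shows "agree_upto N (theta int_square) (1 + 2 * (\<Sum>j\<in>{1..m}. (- 1) ^ j * fps_X ^ (j ^ 2)))"
  unfolding agree_upto_def
proof (intro allI impI)
  fix i assume i: "i \<le> N"
  have coeff: "fps_nth ((- 1) ^ j * fps_X ^ (j ^ 2)) i = (if i = j ^ 2 then (- 1) ^ i else (0 :: int))" for j
  proof -
    have "(- 1) ^ j = fps_const ((- 1) ^ j :: int)"
      by (simp flip: fps_const_power fps_const_neg)
    moreover have "(- 1) ^ (j ^ 2) = ((- 1) ^ j :: int)"
      by (cases "even j") simp_all
    ultimately show ?thesis by (simp add: fps_X_power_nth)
  qed
  have two: "fps_nth (2 * f) i = 2 * fps_nth f i" for f :: "int fps"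
    by (simp only: mult_2 fps_add_nth)
  have "fps_nth (1 + 2 * (\<Sum>j\<in>{1..m}. (- 1) ^ j * fps_X ^ (j ^ 2))) i
    = (if i = 0 then 1 else 0) + 2 * (\<Sum>j\<in>{1..m}. if i = j ^ 2 then (- 1) ^ i else (0 :: int))"
    by (simp add: two fps_sum_nth coeff)
  also have "\<dots> = fps_nth (theta int_square) i"
  proof (cases "i = 0 \<or> \<not> (\<exists>j. i = j ^ 2)")
    case True
    thus ?thesis by (auto simp: theta_def card_int_square intro!: sum.neutral)
  next
    case False
    then obtain j where j: "i = j ^ 2" "j \<noteq> 0" by auto
    \<comment> \<open>The root satisfies j \<le> j^2 = i \<le> N \<le> m, so it lies in the range of
      summation.\<close>
    have "j \<le> j ^ 2" by (simp add: power2_eq_square)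
    hence "j \<in> {1..m}" using j i assms by simp
    moreover have "(\<Sum>k\<in>{1..m}. if i = k ^ 2 then (- 1) ^ i else (0 :: int))
        = (\<Sum>k\<in>{1..m}. if j = k then (- 1) ^ i else 0)"
      by (intro sum.cong refl) (simp add: j(1))
    ultimately have "(\<Sum>k\<in>{1..m}. if i = k ^ 2 then (- 1) ^ i else (0 :: int)) = (- 1) ^ i"
      by (simp only: sum.delta' finite_atLeastAtMost if_True)
    thus ?thesis using False by (simp add: theta_def card_int_square)
  qed
  finally show "fps_nth (theta int_square) i = fps_nth (1 + 2 * (\<Sum>j\<in>{1..m}. (- 1) ^ j * fps_X ^ (j ^ 2))) i" ..
qed

text \<open>The index 2N makes both 2N - j and 2N + j at least N when j \<le> N, so the two
  reciprocals agree with \<open>inv_qfact N\<close> up to degree N. For j > N the power q^(j^2)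
  vanishes up to that degree.\<close>

lemma gauss_sum_agree: "agree_upto N (gauss_sum (2 * N)) (inv_qfact N ^ 2 * theta int_square)"
proof -
  have I: "agree_upto N (inv_qfact m) (inv_qfact N)" if "N \<le> m" for m
    unfolding inv_qfact_def using that by (intro agree_upto_prod_tail agree_upto_geom_fps)
  have summand: "agree_upto N (gauss_term (2 * N) j) (inv_qfact N ^ 2 * ((- 1) ^ j * fps_X ^ (j ^ 2)))" for j
  proof (cases "j \<le> N")
    case True
    hence "agree_upto N (gauss_term (2 * N) j)
        ((- 1) ^ j * fps_X ^ (j ^ 2) * (inv_qfact N * inv_qfact N))"
      unfolding gauss_term_def by (intro agree_upto_mult I) auto
    thus ?thesis by (simp add: power2_eq_square mult_ac)
  next
    case False
    have "j \<le> j ^ 2" by (simp add: power2_eq_square)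
    hence X: "agree_upto N (fps_X ^ (j ^ 2) :: int fps) 0"
      using False by (intro agree_upto_X_power) simp
    have "agree_upto N (gauss_term (2 * N) j) ((- 1) ^ j * 0 * (inv_qfact (2 * N - j) * inv_qfact (2 * N + j)))"
      unfolding gauss_term_def by (intro agree_upto_mult X) auto
    moreover have "agree_upto N (inv_qfact N ^ 2 * ((- 1) ^ j * fps_X ^ (j ^ 2))) (inv_qfact N ^ 2 * ((- 1) ^ j * 0))"
      by (intro agree_upto_mult X) auto
    ultimately show ?thesis by (auto intro: agree_upto_trans agree_upto_sym)
  qed
  have "agree_upto N (gauss_sum (2 * N)) (inv_qfact N ^ 2 +
      2 * (\<Sum>j\<in>{1..2 * N}. inv_qfact N ^ 2 * ((- 1) ^ j * fps_X ^ (j ^ 2))))"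
    unfolding gauss_sum_def power2_eq_square[of "inv_qfact _"]
    by (intro agree_upto_add agree_upto_mult agree_upto_sum I)
      (use summand in \<open>auto simp: power2_eq_square[of "inv_qfact _"]\<close>)
  also have "inv_qfact N ^ 2 + 2 * (\<Sum>j\<in>{1..2 * N}. inv_qfact N ^ 2 * ((- 1) ^ j * fps_X ^ (j ^ 2)))
      = inv_qfact N ^ 2 * (1 + 2 * (\<Sum>j\<in>{1..2 * N}. (- 1) ^ j * fps_X ^ (j ^ 2)))"
    by (simp only: distrib_left mult_1_right sum_distrib_left mult.left_commute[of "inv_qfact N ^ 2" 2])
  finally have "agree_upto N (gauss_sum (2 * N))
      (inv_qfact N ^ 2 * (1 + 2 * (\<Sum>j\<in>{1..2 * N}. (- 1) ^ j * fps_X ^ (j ^ 2))))" .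
  moreover have "agree_upto N (inv_qfact N ^ 2 * (1 + 2 * (\<Sum>j\<in>{1..2 * N}. (- 1) ^ j * fps_X ^ (j ^ 2))))
      (inv_qfact N ^ 2 * theta int_square)"
    by (intro agree_upto_mult agree_upto_sym[OF theta_int_square_agree]) simp_all
  ultimately show ?thesis by (rule agree_upto_trans)
qed

text \<open>Gauss's identity reads I^2 theta = E up to degree N, with I =
  \<open>inv_qfact N\<close>. Multiplying by D Q and using Q I = 1 and D E = I gives (D I) theta =
  1, and D I is the overpartition product.\<close>

lemma overpart_gf_theta: "agree_upto N (overpart_gf N * theta int_square) 1"
proof -
  define D where "D = (\<Prod>k\<in>{1..N}. 1 + fps_X ^ k :: int fps)"
  define Q where "Q = (\<Prod>k\<in>{1..N}. 1 - fps_X ^ k :: int fps)"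
  define E where "E = (\<Prod>k\<in>{1..N}. geom_fps (2 * k))"
  have QI: "Q * inv_qfact N = 1"
    unfolding Q_def inv_qfact_def prod.distrib [symmetric]
    by (intro prod.neutral ballI geom_fps_mult) auto
  have DE: "D * E = inv_qfact N"
    unfolding D_def E_def inv_qfact_def prod.distrib [symmetric]
    by (intro prod.cong refl geom_fps_eq_double [symmetric]) auto
  have "agree_upto N (gauss_sum (2 * N)) E"
    unfolding gauss_sum_eq E_def by (intro agree_upto_prod_tail agree_upto_geom_fps) auto
  hence "agree_upto N (inv_qfact N ^ 2 * theta int_square) E"
    using agree_upto_sym[OF gauss_sum_agree] by (rule agree_upto_trans[rotated])
  hence "agree_upto N (D * Q * (inv_qfact N ^ 2 * theta int_square)) (D * Q * E)"
    by (intro agree_upto_mult) simp_all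
  also have "D * Q * (inv_qfact N ^ 2 * theta int_square)
      = (Q * inv_qfact N) * (D * inv_qfact N * theta int_square)"
    by (simp add: power2_eq_square mult_ac)
  also have "D * Q * E = Q * (D * E)" by (simp add: mult_ac)
  also have "D * inv_qfact N = overpart_gf N"
    by (simp add: D_def inv_qfact_def overpart_gf_def prod.distrib)
  finally show ?thesis by (simp add: QI DE)
qed

definition overpart_fps :: "int fps" where
  "overpart_fps = Abs_fps overpartition_count"

lemma overpart_fps_agree: "agree_upto N overpart_fps (overpart_gf N)"
  unfolding agree_upto_def
proof (intro allI impI)
  fix i assume "i \<le> N"
  moreover have "agree_upto i ((1 + fps_X ^ k) * geom_fps k) ((1 + 0) * 1 :: int fps)" if "i < k" for k
    using that by (intro agree_upto_mult agree_upto_add agree_upto_X_power agree_upto_geom_fps) simp_all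
  ultimately have "agree_upto i (overpart_gf N) (overpart_gf i)"
    unfolding overpart_gf_def by (intro agree_upto_prod_tail) simp_all
  thus "fps_nth overpart_fps i = fps_nth (overpart_gf N) i"
    by (simp add: agree_upto_def overpart_fps_def overpartition_count_def)
qed

lemma overpart_fps_theta: "overpart_fps * theta int_square = 1"
proof (rule fps_ext)
  fix n
  have "agree_upto n (overpart_fps * theta int_square) (overpart_gf n * theta int_square)"
    by (intro agree_upto_mult overpart_fps_agree) simp
  hence "agree_upto n (overpart_fps * theta int_square) 1"
    using overpart_gf_theta by (rule agree_upto_trans)
  thus "fps_nth (overpart_fps * theta int_square) n = fps_nth 1 n"
    by (simp add: agree_upto_def)
qed

section \<open>Integral quaternions\<close>

text \<open>Integer coordinates (the Lipschitz order) are kept instead of the larger Hurwitz order,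
  so that norms are exactly sums of four integer squares.\<close>

datatype quat = Quat (qa: int) (qb: int) (qc: int) (qd: int)

lemma quat_eq_iff: "p = q \<longleftrightarrow> qa p = qa q \<and> qb p = qb q \<and> qc p = qc q \<and> qd p = qd q"
  by (cases p; cases q) auto

instantiation quat :: ring_1
begin

definition "0 = Quat 0 0 0 0"
definition "1 = Quat 1 0 0 0"
definition "- p = Quat (- qa p) (- qb p) (- qc p) (- qd p)"
definition "p + q = Quat (qa p + qa q) (qb p + qb q) (qc p + qc q) (qd p + qd q)"
definition "p - q = Quat (qa p - qa q) (qb p - qb q) (qc p - qc q) (qd p - qd q)"
definition "p * q = Quat
  (qa p * qa q - qb p * qb q - qc p * qc q - qd p * qd q)
  (qa p * qb q + qb p * qa q + qc p * qd q - qd p * qc q)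
  (qa p * qc q - qb p * qd q + qc p * qa q + qd p * qb q)
  (qa p * qd q + qb p * qc q - qc p * qb q + qd p * qa q)"

instance
  by standard
    (simp_all add: zero_quat_def one_quat_def uminus_quat_def plus_quat_def minus_quat_def
      times_quat_def algebra_simps)

end

lemmas quat_defs = zero_quat_def one_quat_def uminus_quat_def plus_quat_def minus_quat_def
  times_quat_def

lemma quat_sel [simp]:
  "qa 0 = 0" "qb 0 = 0" "qc 0 = 0" "qd 0 = 0"
  "qa 1 = 1" "qb 1 = 0" "qc 1 = 0" "qd 1 = 0"
  "qa (- p) = - qa p" "qb (- p) = - qb p" "qc (- p) = - qc p" "qd (- p) = - qd p"
  "qa (p + q) = qa p + qa q" "qb (p + q) = qb p + qb q"
  "qc (p + q) = qc p + qc q" "qd (p + q) = qd p + qd q"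
  "qa (p - q) = qa p - qa q" "qb (p - q) = qb p - qb q"
  "qc (p - q) = qc p - qc q" "qd (p - q) = qd p - qd q"
  by (simp_all add: quat_defs)

lemma quat_sel_mult:
  "qa (p * q) = qa p * qa q - qb p * qb q - qc p * qc q - qd p * qd q"
  "qb (p * q) = qa p * qb q + qb p * qa q + qc p * qd q - qd p * qc q"
  "qc (p * q) = qa p * qc q - qb p * qd q + qc p * qa q + qd p * qb q"
  "qd (p * q) = qa p * qd q + qb p * qc q - qc p * qb q + qd p * qa q"
  by (simp_all add: quat_defs)

lemma quat_of_int: "of_int m = Quat m 0 0 0"
proof -
  have nat: "of_nat k = Quat (int k) 0 0 0" for k
    by (induction k) (simp_all add: quat_eq_iff)
  show ?thesis
    by (cases m rule: int_cases2) (simp_all add: nat quat_eq_iff)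
qed

lemma quat_sel_of_int [simp]:
  "qa (of_int m) = m" "qb (of_int m) = 0" "qc (of_int m) = 0" "qd (of_int m) = 0"
  by (simp_all add: quat_of_int)

lemma quat_sel_numeral [simp]:
  "qa (numeral k) = numeral k" "qb (numeral k) = 0" "qc (numeral k) = 0" "qd (numeral k) = 0"
  using quat_sel_of_int[of "numeral k"] by simp_all

definition qcnj :: "quat \<Rightarrow> quat" where
  "qcnj q = Quat (qa q) (- qb q) (- qc q) (- qd q)"

definition qnorm :: "quat \<Rightarrow> int" where
  "qnorm q = qa q ^ 2 + qb q ^ 2 + qc q ^ 2 + qd q ^ 2"

lemma qcnj_sel [simp]:
  "qa (qcnj q) = qa q" "qb (qcnj q) = - qb q" "qc (qcnj q) = - qc q" "qd (qcnj q) = - qd q"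
  by (simp_all add: qcnj_def)

lemma qcnj_qcnj [simp]: "qcnj (qcnj q) = q"
  by (simp add: quat_eq_iff)

lemma qcnj_mult: "qcnj (p * q) = qcnj q * qcnj p"
  by (simp add: quat_eq_iff quat_sel_mult algebra_simps)

lemma mult_qcnj: "q * qcnj q = of_int (qnorm q)" and qcnj_times: "qcnj q * q = of_int (qnorm q)"
  by (simp_all add: quat_eq_iff quat_sel_mult qnorm_def power2_eq_square)

lemma of_int_commute: "of_int m * q = q * (of_int m :: quat)"
  by (simp add: quat_eq_iff quat_sel_mult)

lemma qnorm_mult: "qnorm (p * q) = qnorm p * qnorm q"
  by (simp add: qnorm_def quat_sel_mult power2_eq_square algebra_simps)

lemma qnorm_qcnj [simp]: "qnorm (qcnj q) = qnorm q"
  by (simp add: qnorm_def)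

lemma qnorm_of_int [simp]: "qnorm (of_int m) = m ^ 2"
  by (simp add: qnorm_def)

lemma qnorm_numeral [simp]: "qnorm (numeral k) = numeral k ^ 2"
  by (simp add: qnorm_def)

lemma qnorm_nonneg [simp]: "0 \<le> qnorm q"
  by (simp add: qnorm_def)

lemma qnorm_0 [simp]: "qnorm 0 = 0" and qnorm_1 [simp]: "qnorm 1 = 1"
  by (simp_all add: qnorm_def)

lemma qnorm_eq_0_iff [simp]: "qnorm q = 0 \<longleftrightarrow> q = 0"
  by (simp add: qnorm_def quat_eq_iff add_nonneg_eq_0_iff)

lemma of_int_mult_eq_iff: "of_int m * p = of_int m * (q::quat) \<longleftrightarrow> m = 0 \<or> p = q"
  by (auto simp: quat_eq_iff quat_sel_mult)

text \<open>The product t = a b satisfies t = 2 Re(t) - conj(t); multiply by a on the right. When a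
  prime divides \<open>qnorm a\<close>, this makes a b a a scalar multiple of a modulo that prime,
  an algebraic form of having rank one.\<close>

lemma quat_sandwich: "a * b * a = of_int (2 * qa (a * b)) * a - of_int (qnorm a) * qcnj b"
  by (simp add: quat_eq_iff quat_sel_mult qnorm_def power2_eq_square algebra_simps)

lemma quat_polarize: "a * z + qcnj z * qcnj a = of_int (2 * qa (a * z))"
  by (simp add: quat_eq_iff quat_sel_mult algebra_simps)

lemma qa_mult_commute: "qa (p * q) = qa (q * p)"
  by (simp add: quat_sel_mult algebra_simps)

definition int_dvd :: "int \<Rightarrow> quat \<Rightarrow> bool" where
  "int_dvd m q \<longleftrightarrow> m dvd qa q \<and> m dvd qb q \<and> m dvd qc q \<and> m dvd qd q"

lemma int_dvd_0 [simp]: "int_dvd m 0"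
  by (simp add: int_dvd_def)

lemma int_dvd_add: "int_dvd m p \<Longrightarrow> int_dvd m q \<Longrightarrow> int_dvd m (p + q)"
  and int_dvd_diff: "int_dvd m p \<Longrightarrow> int_dvd m q \<Longrightarrow> int_dvd m (p - q)"
  by (simp_all add: int_dvd_def)

lemma int_dvd_uminus [simp]: "int_dvd m (- q) \<longleftrightarrow> int_dvd m q"
  by (simp add: int_dvd_def)

lemma int_dvd_qcnj [simp]: "int_dvd m (qcnj q) \<longleftrightarrow> int_dvd m q"
  by (simp add: int_dvd_def)

lemma int_dvd_mult_left: "int_dvd m q \<Longrightarrow> int_dvd m (p * q)"
  and int_dvd_mult_right: "int_dvd m p \<Longrightarrow> int_dvd m (p * q)"
  by (simp_all add: int_dvd_def quat_sel_mult)

lemma int_dvd_of_int_mult: "m dvd k \<Longrightarrow> int_dvd m (of_int k * q)"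
  by (simp add: int_dvd_def quat_sel_mult)

lemma int_dvdE:
  assumes "int_dvd m q"
  obtains p where "q = of_int m * p"
proof
  show "q = of_int m * Quat (qa q div m) (qb q div m) (qc q div m) (qd q div m)"
    using assms by (simp add: int_dvd_def quat_eq_iff quat_sel_mult)
qed

lemma prime_int_dvd_of_int_mult_iff:
  "prime m \<Longrightarrow> int_dvd m (of_int k * q) \<longleftrightarrow> m dvd k \<or> int_dvd m q"
  by (auto simp: int_dvd_def quat_sel_mult prime_dvd_mult_iff)

lemma of_int_mult_cancel_dvd: "m \<noteq> 0 \<Longrightarrow> int_dvd (m * k) (of_int m * q) \<longleftrightarrow> int_dvd k q"
  by (simp add: int_dvd_def quat_sel_mult)

text \<open>The trace form is nondegenerate modulo an odd prime: multiplication by 1, i, j or k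
  moves a coordinate not divisible by l, up to sign, into the real part.\<close>

lemma trace_not_dvd:
  assumes "odd l" "prime l" "\<not> int_dvd l w"
  obtains z where "\<not> l dvd 2 * qa (w * z)"
proof -
  have "\<not> l dvd 2"
    using zdvd_imp_le[of l 2] prime_ge_2_int[OF assms(2)] assms(1) by auto
  hence *: "l dvd 2 * x \<longleftrightarrow> l dvd x" for x
    using assms(2) by (simp add: prime_dvd_mult_iff)
  from assms(3) consider "\<not> l dvd qa w" | "\<not> l dvd qb w" | "\<not> l dvd qc w" | "\<not> l dvd qd w"
    by (auto simp: int_dvd_def)
  thus ?thesis
  proof cases
    case 1 thus ?thesis using that[of "1"] * by simp
  next
    case 2 thus ?thesis using that[of "Quat 0 1 0 0"] * by (simp add: quat_sel_mult)
  next
    case 3 thus ?thesis using that[of "Quat 0 0 1 0"] * by (simp add: quat_sel_mult)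
  next
    case 4 thus ?thesis using that[of "Quat 0 0 0 1"] * by (simp add: quat_sel_mult)
  qed
qed

lemma units_qnorm: "{c. qnorm c = 1} = {Quat 1 0 0 0, Quat (-1) 0 0 0, Quat 0 1 0 0, Quat 0 (-1) 0 0,
  Quat 0 0 1 0, Quat 0 0 (-1) 0, Quat 0 0 0 1, Quat 0 0 0 (-1)}" (is "_ = ?R")
proof (intro equalityI subsetI)
  fix c assume "c \<in> {c. qnorm c = 1}"
  hence n: "qa c ^ 2 + qb c ^ 2 + qc c ^ 2 + qd c ^ 2 = 1" by (simp add: qnorm_def)
  have nn: "0 \<le> qa c ^ 2" "0 \<le> qb c ^ 2" "0 \<le> qc c ^ 2" "0 \<le> qd c ^ 2" by simp_all
  have "qa c ^ 2 \<le> 1" "qb c ^ 2 \<le> 1" "qc c ^ 2 \<le> 1" "qd c ^ 2 \<le> 1"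
    using n nn by linarith+
  hence "\<bar>qa c\<bar> \<le> 1" "\<bar>qb c\<bar> \<le> 1" "\<bar>qc c\<bar> \<le> 1" "\<bar>qd c\<bar> \<le> 1"
    by (simp_all add: abs_square_le_1)
  hence *: "qa c = -1 \<or> qa c = 0 \<or> qa c = 1" "qb c = -1 \<or> qb c = 0 \<or> qb c = 1"
    "qc c = -1 \<or> qc c = 0 \<or> qc c = 1" "qd c = -1 \<or> qd c = 0 \<or> qd c = 1"
    by linarith+
  show "c \<in> ?R"
    using * n by (elim disjE) (simp_all add: quat_eq_iff)
qed (auto simp: qnorm_def)

lemma card_units_qnorm: "card {c. qnorm c = 1} = 8"
  unfolding units_qnorm by simp

section \<open>Division with remainder and left divisors of prime norm\<close>

lemma round_odd:
  fixes m x :: int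
  assumes "odd m" "m > 0"
  obtains y where "2 * \<bar>x - m * y\<bar> < m"
proof
  define y where "y = (2 * x + m) div (2 * m)"
  have "2 * x + m = 2 * m * y + (2 * x + m) mod (2 * m)"
    by (simp add: y_def)
  moreover have "0 \<le> (2 * x + m) mod (2 * m)" "(2 * x + m) mod (2 * m) < 2 * m"
    using assms by simp_all
  \<comment> \<open>Oddness of m excludes the tie, a rounding error of exactly -m/2, and makes the
    bound strict.\<close>
  moreover have "m + 2 * (x - m * y) \<noteq> 0"
    using assms(1) by presburger
  moreover have "m * y * 2 = 2 * m * y" by simp
  ultimately show "2 * \<bar>x - m * y\<bar> < m"
    by (simp add: abs_if algebra_simps)
qed

text \<open>Lipschitz quaternions are not Euclidean, but division by an element of odd norm works:
  the rounding errors of the coordinates are then strictly less than \<open>1/2\<close>.\<close>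

lemma quat_division_odd:
  assumes "odd (qnorm a)"
  obtains c where "qnorm (q - a * c) < qnorm a"
proof -
  define m where "m = qnorm a"
  have m: "odd m" "m > 0"
    using assms qnorm_nonneg[of a] by (auto simp: m_def less_le)
  define p where "p = qcnj a * q"
  obtain x where x: "2 * \<bar>qa p - m * x\<bar> < m" using round_odd[OF m] .
  obtain y where y: "2 * \<bar>qb p - m * y\<bar> < m" using round_odd[OF m] .
  obtain z where z: "2 * \<bar>qc p - m * z\<bar> < m" using round_odd[OF m] .
  obtain t where t: "2 * \<bar>qd p - m * t\<bar> < m" using round_odd[OF m] .
  define c where "c = Quat x y z t"
  have sq: "4 * u ^ 2 < m ^ 2" if "2 * \<bar>u\<bar> < m" for u :: int
  proof -
    have "(2 * \<bar>u\<bar>) ^ 2 < m ^ 2" using that by (intro power_strict_mono) auto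
    thus ?thesis by (simp add: power_mult_distrib)
  qed
  \<comment> \<open>Multiplying by \<open>qcnj a\<close> turns left division by a into
    coordinatewise division by the integer m and scales the norm of the remainder by m.\<close>
  have "p - of_int m * c = qcnj a * (q - a * c)"
    by (simp add: p_def m_def qcnj_times [symmetric] right_diff_distrib mult.assoc)
  hence "m * qnorm (q - a * c) = qnorm (p - of_int m * c)"
    by (simp add: qnorm_mult m_def)
  also have "\<dots> = (qa p - m * x)^2 + (qb p - m * y)^2 + (qc p - m * z)^2 + (qd p - m * t)^2"
    by (simp add: qnorm_def quat_sel_mult c_def)
  also have "\<dots> < m ^ 2"
    using sq[OF x] sq[OF y] sq[OF z] sq[OF t] by linarith
  finally have "qnorm (q - a * c) < m"
    using m by (simp add: power2_eq_square)
  thus ?thesis using that by (simp add: m_def)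
qed

text \<open>An even norm has an even coordinate sum, so the coordinates split into two pairs of
  equal parity. Multiplying by a suitable e of norm 2 replaces them by sums and differences within
  the pairs, all even.\<close>

lemma quat_halve:
  assumes "even (qnorm r)"
  shows "\<exists>e r'. of_int 2 * r' = r * e \<and> 2 * qnorm r' = qnorm r"
proof -
  have halve: ?thesis if "int_dvd 2 (r * e)" "qnorm e = 2" for e
  proof -
    obtain r' where r': "r * e = of_int 2 * r'" using \<open>int_dvd 2 (r * e)\<close> by (rule int_dvdE)
    have "qnorm (of_int 2 * r') = qnorm (r * e)" using r' by simp
    hence "2 * qnorm r' = qnorm r" using that(2) unfolding qnorm_mult by simp
    thus ?thesis using r' by (intro exI[of _ e] exI[of _ r']) auto
  qed
  have "even (qa r + qb r + qc r + qd r)"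
    using assms by (simp add: qnorm_def)
  then consider "even (qa r + qb r)" "even (qc r + qd r)" | "even (qa r + qc r)" "even (qb r + qd r)"
    | "even (qa r + qd r)" "even (qb r + qc r)" by auto
  thus ?thesis
  proof cases
    case 1 thus ?thesis
      by (intro halve[of "Quat 1 (-1) 0 0"]) (auto simp: int_dvd_def quat_sel_mult qnorm_def)
  next
    case 2 thus ?thesis
      by (intro halve[of "Quat 1 0 (-1) 0"]) (auto simp: int_dvd_def quat_sel_mult qnorm_def)
  next
    case 3 thus ?thesis
      by (intro halve[of "Quat 1 0 0 (-1)"]) (auto simp: int_dvd_def quat_sel_mult qnorm_def)
  qed
qed

text \<open>Division works only by elements of odd norm, so a nonzero remainder must be made odd.
  Replacing r by r e / 2 halves the norm and keeps l dividing v r, because l is odd.\<close>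

lemma odd_descent:
  assumes "prime l" "odd l" "int_dvd l (v * r)" "r \<noteq> 0"
  obtains r' where "int_dvd l (v * r')" "odd (qnorm r')" "qnorm r' \<le> qnorm r"
proof -
  have "\<exists>r'. int_dvd l (v * r') \<and> odd (qnorm r') \<and> qnorm r' \<le> qnorm r"
    using assms(3,4)
  proof (induction "nat (qnorm r)" arbitrary: r rule: less_induct)
    case less
    show ?case
    proof (cases "even (qnorm r)")
      case True
      then obtain e s where es: "of_int 2 * s = r * e" "2 * qnorm s = qnorm r"
        using quat_halve by blast
      have pos: "qnorm r > 0"
        using less.prems(2) qnorm_nonneg[of r] by (simp add: less_le)
      hence "s \<noteq> 0" using es(2) by auto
      have "of_int 2 * (v * s) = v * r * e"
        using arg_cong[OF es(1), of "\<lambda>x. v * x"] of_int_commute[of 2 v]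
        by (simp add: mult.assoc [symmetric])
      hence "int_dvd l (of_int 2 * (v * s))"
        using int_dvd_mult_right[OF less.prems(1), of e] by simp
      moreover have "\<not> l dvd 2"
        using zdvd_imp_le[of l 2] prime_ge_2_int[OF assms(1)] assms(2) by auto
      ultimately have "int_dvd l (v * s)"
        using prime_int_dvd_of_int_mult_iff[OF assms(1), of 2 "v * s"] by simp
      moreover have "nat (qnorm s) < nat (qnorm r)" using es(2) pos by linarith
      ultimately obtain r' where "int_dvd l (v * r') \<and> odd (qnorm r') \<and> qnorm r' \<le> qnorm s"
        using less.hyps \<open>s \<noteq> 0\<close> by blast
      moreover have "qnorm s \<le> qnorm r" using es(2) pos by linarith
      ultimately show ?thesis by (intro exI[of _ r']) auto
    qed (use less.prems in blast)
  qed
  thus ?thesis using that by blast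
qed

lemma prime_divisor_of_square:
  fixes m l :: int
  assumes "prime l" "m dvd l ^ 2" "m > 0"
  shows "m = 1 \<or> m = l \<or> m = l ^ 2"
proof -
  have "l > 0" using assms(1) prime_gt_0_int by blast
  obtain i where i: "i \<le> 2" "normalize m = l ^ i"
    by (rule divides_primepow[OF assms(1,2)])
  hence m: "m = l ^ i" using assms(3) \<open>l > 0\<close> by simp
  from i(1) consider "i = 0" | "i = 1" | "i = 2" by linarith
  thus ?thesis using m by cases simp_all
qed

text \<open>For a of norm l, the condition says that a divides w on the left, as a times
  \<open>qcnj a\<close> is l. It is symmetric up to conjugation, so it places a in the right ideal
  J. An element of least odd norm generates J and turns out to have norm l; the elements of norm l
  in J are its products with the eight units.\<close>

lemma card_left_divisors:
  assumes l: "prime l" "odd l" and w: "l dvd qnorm w" "\<not> int_dvd l w"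
  shows "card {a. qnorm a = l \<and> int_dvd l (qcnj a * w)} = 8"
proof -
  define J where "J = (\<lambda>q. int_dvd l (qcnj w * q))"
  have J_cnj: "int_dvd l (qcnj a * w) = J a" for a
    using int_dvd_qcnj[of l "qcnj a * w"] by (simp add: J_def qcnj_mult)
  have l0: "l > 1" using l(1) prime_gt_1_int by blast
  have J_dvd: "l dvd qnorm q" if "J q" for q
  proof -
    have "int_dvd l (qcnj w * q * qcnj q)" using that unfolding J_def by (rule int_dvd_mult_right)
    hence "int_dvd l (of_int (qnorm q) * qcnj w)"
      by (simp add: mult.assoc mult_qcnj of_int_commute)
    thus ?thesis using w(2) by (simp add: prime_int_dvd_of_int_mult_iff[OF l(1)])
  qed
  have Jl: "J (of_int l)"
    using int_dvd_of_int_mult[of l l "qcnj w"] by (simp add: J_def of_int_commute)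
  have Jw: "J w"
    using int_dvd_of_int_mult[OF w(1), of 1] by (simp add: J_def qcnj_times)
  \<comment> \<open>J contains l, whose norm l^2 is odd, so a least odd norm exists.\<close>
  have "\<exists>a. (J a \<and> odd (qnorm a)) \<and> (\<forall>y. J y \<and> odd (qnorm y) \<longrightarrow> nat (qnorm a) \<le> nat (qnorm y))"
    by (rule ex_has_least_nat) (use Jl l(2) in auto)
  then obtain a where a: "J a" "odd (qnorm a)"
    and min: "\<And>y. J y \<Longrightarrow> odd (qnorm y) \<Longrightarrow> qnorm a \<le> qnorm y"
    by (auto simp: nat_le_eq_zle)
  have a0: "a \<noteq> 0" using a(2) by auto
  have principal: "\<exists>c. q = a * c" if q: "J q" for q
  proof -
    obtain c where c: "qnorm (q - a * c) < qnorm a" by (rule quat_division_odd[OF a(2)])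
    have "J (q - a * c)"
      using q a(1) unfolding J_def
      by (simp add: right_diff_distrib mult.assoc [symmetric] int_dvd_diff int_dvd_mult_right)
    have "q - a * c = 0"
    proof (rule ccontr)
      assume "q - a * c \<noteq> 0"
      then obtain r where "J r" "odd (qnorm r)" "qnorm r \<le> qnorm (q - a * c)"
        using odd_descent[OF l] \<open>J (q - a * c)\<close> unfolding J_def by blast
      thus False using min[of r] c by simp
    qed
    thus ?thesis by (intro exI[of _ c]) simp
  qed
  have na: "qnorm a = l"
  proof -
    obtain c where c: "of_int l = a * c" using principal[OF Jl] by blast
    hence lc: "l ^ 2 = qnorm a * qnorm c" using qnorm_mult[of a c] by (simp add: c [symmetric])
    have "qnorm a > 0" using a0 qnorm_nonneg[of a] by (simp add: less_le)
    with lc prime_divisor_of_square[OF l(1), of "qnorm a"] 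
    consider "qnorm a = 1" | "qnorm a = l" | "qnorm a = l ^ 2" by auto
    thus ?thesis
    proof cases
      case 1 thus ?thesis using J_dvd[OF a(1)] l0 by simp
    next
      \<comment> \<open>Here c is a unit, so a is l times a unit and w, a right multiple of a, would
        be divisible by l.\<close>
      case 3
      with lc l0 have "qnorm c = 1" by simp
      hence "a = of_int l * qcnj c"
        by (simp add: c mult.assoc mult_qcnj)
      moreover obtain d where "w = a * d" using principal[OF Jw] by blast
      ultimately have "int_dvd l w" by (simp add: mult.assoc int_dvd_of_int_mult)
      thus ?thesis using w(2) by simp
    qed
  qed
  have "{b. qnorm b = l \<and> int_dvd l (qcnj b * w)} = (\<lambda>c. a * c) ` {c. qnorm c = 1}"
  proof (intro equalityI subsetI)
    fix b assume "b \<in> {b. qnorm b = l \<and> int_dvd l (qcnj b * w)}"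
    hence b: "qnorm b = l" "J b" by (auto simp: J_cnj)
    obtain c where c: "b = a * c" using principal[OF b(2)] by blast
    hence "qnorm c = 1" using b(1) na l0 by (auto simp: qnorm_mult)
    thus "b \<in> (\<lambda>c. a * c) ` {c. qnorm c = 1}" using c by blast
  next
    fix b assume "b \<in> (\<lambda>c. a * c) ` {c. qnorm c = 1}"
    then obtain c where c: "b = a * c" "qnorm c = 1" by auto
    have "J b" using a(1) unfolding J_def c by (simp add: mult.assoc [symmetric] int_dvd_mult_right)
    thus "b \<in> {b. qnorm b = l \<and> int_dvd l (qcnj b * w)}"
      using c na by (simp add: J_cnj qnorm_mult)
  qed
  moreover have "inj_on (\<lambda>c. a * c) {c. qnorm c = 1}"
  proof (rule inj_onI)
    fix x y assume "a * x = a * y"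
    hence "of_int (qnorm a) * x = of_int (qnorm a) * y"
      by (simp add: qcnj_times [symmetric] mult.assoc)
    thus "x = y" using a0 by (simp add: of_int_mult_eq_iff)
  qed
  ultimately show ?thesis by (simp add: card_image card_units_qnorm)
qed

section \<open>Counting quaternions of given norm\<close>

text \<open>The cardinalities of \<open>norm_sphere n\<close> and \<open>pure_sphere n\<close> are
  r_4(n) and r_3(n).\<close>

definition norm_sphere :: "int \<Rightarrow> quat set" where
  "norm_sphere n = {q. qnorm q = n}"

definition pure_sphere :: "int \<Rightarrow> quat set" where
  "pure_sphere n = {q. qa q = 0 \<and> qnorm q = n}"

lemma finite_norm_sphere [simp]: "finite (norm_sphere n)"
proof (rule finite_subset)
  show "finite ((\<lambda>(a, b, c, d). Quat a b c d) ` ({- n..n} \<times> {- n..n} \<times> {- n..n} \<times> {- n..n}))"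
    by simp
  show "norm_sphere n \<subseteq> (\<lambda>(a, b, c, d). Quat a b c d) ` ({- n..n} \<times> {- n..n} \<times> {- n..n} \<times> {- n..n})"
  proof
    fix q assume "q \<in> norm_sphere n"
    hence n: "qa q ^ 2 + qb q ^ 2 + qc q ^ 2 + qd q ^ 2 = n"
      by (simp add: norm_sphere_def qnorm_def)
    have bound: "x \<in> {- n..n}" if "x ^ 2 \<le> n" for x
    proof -
      have "\<bar>x\<bar> \<le> \<bar>x\<bar> * \<bar>x\<bar>"
        using mult_left_mono[of 1 "\<bar>x\<bar>" "\<bar>x\<bar>"] by (cases "x = 0") auto
      hence "\<bar>x\<bar> \<le> x ^ 2" by (simp add: power2_eq_square)
      with that show ?thesis by auto
    qed
    have nn: "0 \<le> qa q ^ 2" "0 \<le> qb q ^ 2" "0 \<le> qc q ^ 2" "0 \<le> qd q ^ 2" by simp_all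
    have "qa q ^ 2 \<le> n" "qb q ^ 2 \<le> n" "qc q ^ 2 \<le> n" "qd q ^ 2 \<le> n"
      using n nn by linarith+
    hence "(qa q, qb q, qc q, qd q) \<in> {- n..n} \<times> {- n..n} \<times> {- n..n} \<times> {- n..n}"
      using bound by blast
    thus "q \<in> (\<lambda>(a, b, c, d). Quat a b c d) ` ({- n..n} \<times> {- n..n} \<times> {- n..n} \<times> {- n..n})"
      by (rule rev_image_eqI) simp
  qed
qed

lemma pure_sphere_subset: "pure_sphere n \<subseteq> norm_sphere n"
  by (auto simp: pure_sphere_def norm_sphere_def)

lemma finite_pure_sphere [simp]: "finite (pure_sphere n)"
  using finite_subset[OF pure_sphere_subset] by simp

lemma card_swap_pairs:
  assumes "finite A" "finite B"
  shows "(\<Sum>a\<in>A. card {b\<in>B. R a b}) = (\<Sum>b\<in>B. card {a\<in>A. R a b})"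
proof -
  have "card {b\<in>B. R a b} = (\<Sum>b\<in>B. if R a b then 1 else 0)" for a
    using assms(2) by (simp add: sum.If_cases Int_def)
  moreover have "card {a\<in>A. R a b} = (\<Sum>a\<in>A. if R a b then 1 else 0)" for b
    using assms(1) by (simp add: sum.If_cases Int_def)
  ultimately show ?thesis by (simp add: sum.swap[of _ A])
qed

lemma card_norm_sphere_int_dvd:
  assumes "l \<noteq> 0"
  shows "card {w \<in> norm_sphere (l ^ 2 * n). int_dvd l w} = card (norm_sphere n)"
    and "card {w \<in> pure_sphere (l ^ 2 * n). int_dvd l w} = card (pure_sphere n)"
proof -
  have inj: "inj_on (\<lambda>u. of_int l * u) A" for A :: "quat set"
    using assms by (auto simp: inj_on_def of_int_mult_eq_iff)
  have "{w \<in> norm_sphere (l ^ 2 * n). int_dvd l w} = (\<lambda>u. of_int l * u) ` norm_sphere n"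
    using assms by (auto simp: norm_sphere_def qnorm_mult int_dvd_of_int_mult elim!: int_dvdE)
  thus "card {w \<in> norm_sphere (l ^ 2 * n). int_dvd l w} = card (norm_sphere n)"
    by (simp add: card_image inj)
  have "{w \<in> pure_sphere (l ^ 2 * n). int_dvd l w} = (\<lambda>u. of_int l * u) ` pure_sphere n"
    using assms
    by (auto simp: pure_sphere_def qnorm_mult int_dvd_of_int_mult quat_sel_mult elim!: int_dvdE)
  thus "card {w \<in> pure_sphere (l ^ 2 * n). int_dvd l w} = card (pure_sphere n)"
    by (simp add: card_image inj)
qed

text \<open>Multiplying the condition by a on the left and cancelling l gives w = a b, so b
  \<mapsto> a b is the required bijection.\<close>

lemma card_left_multiples:
  assumes "qnorm a = l" "l \<noteq> 0"
  shows "card {w \<in> norm_sphere (l * n). int_dvd l (qcnj a * w)} = card (norm_sphere n)"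
proof -
  have a0: "a \<noteq> 0" using assms by auto
  have "{w \<in> norm_sphere (l * n). int_dvd l (qcnj a * w)} = (\<lambda>b. a * b) ` norm_sphere n"
  proof (intro equalityI subsetI)
    fix w assume "w \<in> {w \<in> norm_sphere (l * n). int_dvd l (qcnj a * w)}"
    hence w: "qnorm w = l * n" "int_dvd l (qcnj a * w)" by (auto simp: norm_sphere_def)
    then obtain b where b: "qcnj a * w = of_int l * b" by (auto elim: int_dvdE)
    have "of_int l * w = a * (qcnj a * w)" by (simp add: mult.assoc [symmetric] mult_qcnj assms)
    also have "\<dots> = of_int l * (a * b)"
      using of_int_commute[of l a] by (simp add: b mult.assoc [symmetric])
    finally have ab: "w = a * b" using assms by (simp add: of_int_mult_eq_iff)
    hence "qnorm b = n" using w assms by (simp add: qnorm_mult)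
    thus "w \<in> (\<lambda>b. a * b) ` norm_sphere n" using ab by (simp add: norm_sphere_def)
  next
    fix w assume "w \<in> (\<lambda>b. a * b) ` norm_sphere n"
    then obtain b where b: "w = a * b" "qnorm b = n" by (auto simp: norm_sphere_def)
    thus "w \<in> {w \<in> norm_sphere (l * n). int_dvd l (qcnj a * w)}"
      using assms by (simp add: norm_sphere_def qnorm_mult mult.assoc [symmetric] qcnj_times
          int_dvd_of_int_mult)
  qed
  moreover have "inj_on (\<lambda>b. a * b) (norm_sphere n)"
  proof (rule inj_onI)
    fix x y assume "a * x = a * y"
    hence "of_int (qnorm a) * x = of_int (qnorm a) * y"
      by (simp add: qcnj_times [symmetric] mult.assoc)
    thus "x = y" using a0 by (simp add: of_int_mult_eq_iff)
  qed
  ultimately show ?thesis by (simp add: card_image)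
qed

text \<open>Count pairs (a, b) of norms l and n by w = a b. A w not divisible by l has eight left
  divisors of norm l; a multiple of l has every element of norm l as a left divisor.\<close>

lemma card_norm_sphere_prime_mult:
  assumes l: "prime l" "odd l"
  shows "card (norm_sphere l) * card (norm_sphere n) =
    8 * card {w \<in> norm_sphere (l * n). \<not> int_dvd l w} +
    card (norm_sphere l) * card {w \<in> norm_sphere (l * n). int_dvd l w}"
proof -
  let ?R = "\<lambda>a w. int_dvd l (qcnj a * w)"
  let ?W = "norm_sphere (l * n)"
  have l0: "l \<noteq> 0" using l(1) by auto
  have "card (norm_sphere l) * card (norm_sphere n) =
      (\<Sum>a\<in>norm_sphere l. card {w \<in> ?W. ?R a w})"
    using card_left_multiples[OF _ l0] by (simp add: norm_sphere_def)
  also have "\<dots> = (\<Sum>w\<in>?W. card {a \<in> norm_sphere l. ?R a w})"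
    by (rule card_swap_pairs) simp_all
  also have "\<dots> = (\<Sum>w\<in>?W. if int_dvd l w then card (norm_sphere l) else 8)"
  proof (rule sum.cong [OF refl])
    fix w assume "w \<in> ?W"
    hence "l dvd qnorm w" by (simp add: norm_sphere_def)
    thus "card {a \<in> norm_sphere l. ?R a w} = (if int_dvd l w then card (norm_sphere l) else 8)"
      using card_left_divisors[OF l, of w] int_dvd_mult_left[of l w]
      by (auto simp: norm_sphere_def)
  qed
  also have "\<dots> = (\<Sum>w\<in>{w \<in> ?W. int_dvd l w}. card (norm_sphere l)) + (\<Sum>w\<in>{w \<in> ?W. \<not> int_dvd l w}. 8)"
    by (simp add: sum.If_cases Int_def)
  finally show ?thesis by (simp add: mult.commute)
qed

section \<open>Conjugates of pure quaternions by quaternions of prime norm\<close>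

lemma not_int_dvd_if_qnorm_eq:
  assumes "qnorm a = l" "l > 1"
  shows "\<not> int_dvd l a"
proof
  assume "int_dvd l a"
  then obtain b where "a = of_int l * b" by (rule int_dvdE)
  hence "l = l ^ 2 * qnorm b" using assms by (auto simp: qnorm_mult)
  hence "l * qnorm b = 1" using assms by (simp add: power2_eq_square)
  hence "l dvd 1" by (metis dvd_triv_left)
  thus False using assms by simp
qed

lemma pure_qcnj: "qa u = 0 \<Longrightarrow> qcnj u = - u"
  by (simp add: quat_eq_iff)

text \<open>Modulo \<open>l\<close> the ring is a matrix ring and \<open>a\<close> has rank one; \<open>qcnj a * u * a = 0\<close> says that
  \<open>u\<close> preserves the image of \<open>a\<close>, so \<open>u\<close> has an eigenvalue, a square root of \<open>- qnorm u\<close>.\<close>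

lemma quadratic_residue_if_conj_dvd:
  assumes l: "prime l" "odd l" and a: "qnorm a = l" and u: "qa u = 0" "int_dvd l (qcnj a * u * a)"
  shows "QuadRes l (- qnorm u)"
proof -
  define n where "n = qnorm u"
  have l1: "l > 1" using l(1) prime_gt_1_int by blast
  have na: "\<not> int_dvd l a" by (rule not_int_dvd_if_qnorm_eq[OF a l1])
  then obtain z where z: "\<not> l dvd 2 * qa (a * z)"
    using trace_not_dvd[OF l(2,1)] by blast
  define \<tau> where "\<tau> = 2 * qa (a * z)"
  define \<mu> where "\<mu> = 2 * qa (a * (z * u))"
  \<comment> \<open>Modulo l, \<open>\<tau>\<close> u a = \<open>\<mu>\<close> a: the term with
    \<open>qcnj a * u * a\<close> vanishes by hypothesis, and a (z u) a is a multiple of a by the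
    sandwich identity. The eigenvalue is \<open>\<mu>\<close> / \<open>\<tau>\<close>.\<close>
  have "of_int \<tau> * (u * a) = (a * z + qcnj z * qcnj a) * (u * a)"
    by (simp only: quat_polarize \<tau>_def)
  also have "\<dots> = a * (z * u) * a + qcnj z * (qcnj a * u * a)"
    by (simp add: algebra_simps)
  also have "a * (z * u) * a = of_int \<mu> * a - of_int l * qcnj (z * u)"
    by (simp only: quat_sandwich \<mu>_def a)
  finally have "of_int \<tau> * (u * a) - of_int \<mu> * a = qcnj z * (qcnj a * u * a) - of_int l * qcnj (z * u)"
    by (simp add: algebra_simps)
  hence D: "int_dvd l (of_int \<tau> * (u * a) - of_int \<mu> * a)"
    using u(2) by (simp add: int_dvd_diff int_dvd_mult_left int_dvd_of_int_mult)
  \<comment> \<open>A pure u has u^2 = -n, so (\<open>\<tau>\<close> u +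
    \<open>\<mu>\<close>)(\<open>\<tau>\<close> u - \<open>\<mu>\<close>) is an integer. It
    annihilates a modulo l, hence is divisible by l.\<close>
  have "of_int (- n * \<tau> ^ 2 - \<mu> ^ 2) * a
      = (of_int \<tau> * u + of_int \<mu>) * (of_int \<tau> * (u * a) - of_int \<mu> * a)"
    using u(1) by (simp add: quat_eq_iff quat_sel_mult n_def qnorm_def power2_eq_square algebra_simps)
  hence "int_dvd l (of_int (- n * \<tau> ^ 2 - \<mu> ^ 2) * a)"
    using int_dvd_mult_left[OF D] by simp
  hence dvd: "l dvd - n * \<tau> ^ 2 - \<mu> ^ 2"
    using na prime_int_dvd_of_int_mult_iff[OF l(1)] by blast
  have "coprime \<tau> l"
    using prime_imp_coprime[OF l(1) z] unfolding \<tau>_def by (rule coprime_commute[THEN iffD1])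
  then obtain s where s: "[\<tau> * s = 1] (mod l)"
    using cong_solve_coprime_int by blast
  have "[\<mu> ^ 2 * s ^ 2 = - n * \<tau> ^ 2 * s ^ 2] (mod l)"
    using dvd by (intro cong_mult cong_refl) (simp add: cong_iff_dvd_diff dvd_diff_commute)
  also have "- n * \<tau> ^ 2 * s ^ 2 = - n * (\<tau> * s) ^ 2" by (simp add: power_mult_distrib)
  also have "[- n * (\<tau> * s) ^ 2 = - n * 1 ^ 2] (mod l)"
    by (intro cong_mult cong_pow s cong_refl)
  finally have "[(\<mu> * s) ^ 2 = - n] (mod l)" by (simp add: power_mult_distrib)
  thus ?thesis unfolding QuadRes_def n_def by blast
qed

text \<open>This reduces counting conjugates to counting left divisors. For the converse write w = a
  b; purity of w gives l | w a, and l | b a is needed. Since l | \<open>qnorm b\<close>, the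
  sandwich identity gives tr(w z) b = b z a b modulo l. Multiplying by a on the right yields tr(w z)
  b a = b z (w a) = 0, and z can be chosen with tr(w z) not divisible by l.\<close>

lemma conj_dvd_square_iff:
  assumes l: "prime l" "odd l" and a: "qnorm a = l"
    and w: "qa w = 0" "l ^ 2 dvd qnorm w" "\<not> int_dvd l w"
  shows "int_dvd (l ^ 2) (qcnj a * w * a) \<longleftrightarrow> int_dvd l (qcnj a * w)"
proof
  have l0: "l \<noteq> 0" using l(1) by auto
  {
    assume "int_dvd (l ^ 2) (qcnj a * w * a)"
    hence "int_dvd (l ^ 2) (qcnj a * w * a * qcnj a)" by (rule int_dvd_mult_right)
    moreover have "qcnj a * w * a * qcnj a = of_int l * (qcnj a * w)"
      by (simp only: mult.assoc mult_qcnj a of_int_commute[of l "qcnj a * w"])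
    ultimately show "int_dvd l (qcnj a * w)"
      using of_int_mult_cancel_dvd[OF l0, of l] by (simp add: power2_eq_square)
  next
    assume aw: "int_dvd l (qcnj a * w)"
    then obtain b where b: "qcnj a * w = of_int l * b" by (rule int_dvdE)
    have "of_int l * w = a * (qcnj a * w)" by (simp add: mult.assoc [symmetric] mult_qcnj a)
    also have "\<dots> = of_int l * (a * b)"
      using of_int_commute[of l a] by (simp add: b mult.assoc [symmetric])
    finally have ab: "w = a * b" using l0 by (simp add: of_int_mult_eq_iff)
    have nb: "l dvd qnorm b"
      using w(2) l0 by (simp add: ab qnorm_mult a power2_eq_square)
    have "qcnj (qcnj a * w) = - (w * a)" using w(1) by (simp add: qcnj_mult pure_qcnj)
    hence wa: "int_dvd l (w * a)" using int_dvd_qcnj[of l "qcnj a * w"] aw by simp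
    obtain z where z: "\<not> l dvd 2 * qa (w * z)" by (rule trace_not_dvd[OF l(2,1) w(3)])
    have "qa (b * (z * a)) = qa (w * z)"
      using qa_mult_commute[of "b * z" a] by (simp add: ab mult.assoc)
    hence "b * (z * a) * b * a = (of_int (2 * qa (w * z)) * b - of_int (qnorm b) * qcnj (z * a)) * a"
      by (simp only: quat_sandwich)
    hence "of_int (2 * qa (w * z)) * (b * a) = b * z * (w * a) + of_int (qnorm b) * (qcnj (z * a) * a)"
      by (simp add: ab algebra_simps)
    moreover have "int_dvd l (b * z * (w * a) + of_int (qnorm b) * (qcnj (z * a) * a))"
      by (intro int_dvd_add int_dvd_mult_left[OF wa] int_dvd_of_int_mult[OF nb])
    ultimately have "int_dvd l (b * a)"
      using z prime_int_dvd_of_int_mult_iff[OF l(1), of "2 * qa (w * z)" "b * a"] by simp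
    moreover have "qcnj a * w * a = of_int l * (b * a)" by (simp add: b mult.assoc)
    ultimately show "int_dvd (l ^ 2) (qcnj a * w * a)"
      using of_int_mult_cancel_dvd[OF l0, of l] by (simp add: power2_eq_square)
  }
qed

text \<open>The bijection is v \<mapsto> a v a' with a' = \<open>qcnj a\<close>; conjugating back, w
  \<mapsto> a' w a, multiplies v by l^2.\<close>

lemma card_conj_multiples:
  assumes a: "qnorm a = l" and l0: "l \<noteq> 0"
  shows "card {w \<in> pure_sphere (l ^ 2 * n). int_dvd (l ^ 2) (qcnj a * w * a)} = card (pure_sphere n)"
proof -
  have a0: "a \<noteq> 0" using a l0 by auto
  have inv: "qcnj a * (a * v * qcnj a) * a = of_int (l ^ 2) * v" for v
  proof -
    have "qcnj a * (a * v * qcnj a) * a = (qcnj a * a) * (v * (qcnj a * a))"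
      by (simp add: mult.assoc)
    also have "\<dots> = of_int l * (of_int l * v)"
      by (simp only: qcnj_times a of_int_commute[of l v])
    finally show ?thesis by (simp add: power2_eq_square mult.assoc)
  qed
  have inv': "a * (qcnj a * w * a) * qcnj a = of_int (l ^ 2) * w" for w
  proof -
    have "a * (qcnj a * w * a) * qcnj a = (a * qcnj a) * (w * (a * qcnj a))"
      by (simp add: mult.assoc)
    also have "\<dots> = of_int l * (of_int l * w)"
      by (simp only: mult_qcnj a of_int_commute[of l w])
    finally show ?thesis by (simp add: power2_eq_square mult.assoc)
  qed
  have pure: "qa (c * v * qcnj c) = 0" if "qa v = 0" for c v
    using that by (simp add: quat_sel_mult algebra_simps)
  have "{w \<in> pure_sphere (l ^ 2 * n). int_dvd (l ^ 2) (qcnj a * w * a)} = (\<lambda>v. a * v * qcnj a) ` pure_sphere n"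
  proof (intro equalityI subsetI)
    fix w assume "w \<in> {w \<in> pure_sphere (l ^ 2 * n). int_dvd (l ^ 2) (qcnj a * w * a)}"
    hence w: "qa w = 0" "qnorm w = l ^ 2 * n" "int_dvd (l ^ 2) (qcnj a * w * a)"
      by (auto simp: pure_sphere_def)
    from w(3) obtain v where v: "qcnj a * w * a = of_int (l ^ 2) * v" by (rule int_dvdE)
    have "of_int (l ^ 2) * w = a * of_int (l ^ 2) * (v * qcnj a)"
      using inv'[of w] unfolding v by (simp only: mult.assoc)
    also have "\<dots> = of_int (l ^ 2) * (a * v * qcnj a)"
      unfolding of_int_commute[of "l ^ 2" a, symmetric] by (simp only: mult.assoc)
    finally have "of_int (l ^ 2) * w = of_int (l ^ 2) * (a * v * qcnj a)" .
    hence wv: "w = a * v * qcnj a" using l0 by (simp only: of_int_mult_eq_iff) simp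
    hence "l ^ 2 * qnorm v = l ^ 2 * n"
      using w(2) by (simp add: qnorm_mult a power2_eq_square mult_ac)
    hence "qnorm v = n" using l0 by simp
    moreover have "qa (of_int (l ^ 2) * v) = 0"
      using pure[OF w(1), of "qcnj a"] by (simp add: v)
    hence "l ^ 2 * qa v = 0" by (simp add: quat_sel_mult del: of_int_power)
    hence "qa v = 0" using l0 by simp
    ultimately show "w \<in> (\<lambda>v. a * v * qcnj a) ` pure_sphere n"
      using wv by (auto simp: pure_sphere_def)
  next
    fix w assume "w \<in> (\<lambda>v. a * v * qcnj a) ` pure_sphere n"
    then obtain v where v: "w = a * v * qcnj a" "qa v = 0" "qnorm v = n"
      by (auto simp: pure_sphere_def)
    have "int_dvd (l ^ 2) (qcnj a * w * a)"
      unfolding v(1) inv by (rule int_dvd_of_int_mult) simp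
    thus "w \<in> {w \<in> pure_sphere (l ^ 2 * n). int_dvd (l ^ 2) (qcnj a * w * a)}"
      using pure[OF v(2)] v a by (simp add: pure_sphere_def qnorm_mult power2_eq_square)
  qed
  moreover have "inj_on (\<lambda>v. a * v * qcnj a) (pure_sphere n)"
  proof (rule inj_onI)
    fix x y assume "a * x * qcnj a = a * y * qcnj a"
    hence "of_int (l ^ 2) * x = of_int (l ^ 2) * y"
      using inv[of x] inv[of y] by simp
    thus "x = y" using l0 by (simp only: of_int_mult_eq_iff) simp
  qed
  ultimately show ?thesis by (simp add: card_image)
qed

text \<open>Count pairs (a, v) of norms l and n by w = a v a'. A w not divisible by l arises from
  eight a, a multiple of l from none. As r_3(n) of the w are multiples of l, r_4(l) r_3(n) = 8
  (r_3(l^2 n) - r_3(n)).\<close>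

lemma card_pure_sphere_square_mult:
  assumes l: "prime l" "odd l" and n: "\<not> QuadRes l (- n)"
  shows "card (norm_sphere l) * card (pure_sphere n) + 8 * card (pure_sphere n)
    = 8 * card (pure_sphere (l ^ 2 * n))"
proof -
  let ?R = "\<lambda>a w. int_dvd (l ^ 2) (qcnj a * w * a)"
  let ?W = "pure_sphere (l ^ 2 * n)"
  have l0: "l \<noteq> 0" using l(1) by auto
  have "card (norm_sphere l) * card (pure_sphere n) = (\<Sum>a\<in>norm_sphere l. card {w \<in> ?W. ?R a w})"
    using card_conj_multiples[OF _ l0] by (simp add: norm_sphere_def)
  also have "\<dots> = (\<Sum>w\<in>?W. card {a \<in> norm_sphere l. ?R a w})"
    by (rule card_swap_pairs) simp_all
  also have "\<dots> = (\<Sum>w\<in>?W. if int_dvd l w then 0 else 8)"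
  proof (rule sum.cong [OF refl])
    fix w assume "w \<in> ?W"
    hence w: "qa w = 0" "qnorm w = l ^ 2 * n" by (auto simp: pure_sphere_def)
    show "card {a \<in> norm_sphere l. ?R a w} = (if int_dvd l w then 0 else 8)"
    proof (cases "int_dvd l w")
      case True
      then obtain u where u: "w = of_int l * u" by (rule int_dvdE)
      have nu: "qa u = 0" "qnorm u = n" using w l0 by (auto simp: u quat_sel_mult qnorm_mult)
      have "\<not> ?R a w" if a: "qnorm a = l" for a
      proof
        assume "?R a w"
        moreover have "qcnj a * w * a = of_int l * (qcnj a * u * a)"
          using of_int_commute[of l "qcnj a"] by (simp add: u mult.assoc [symmetric])
        ultimately have "int_dvd l (qcnj a * u * a)"
          using of_int_mult_cancel_dvd[OF l0, of l] by (simp add: power2_eq_square)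
        from quadratic_residue_if_conj_dvd[OF l a nu(1) this] n nu(2) show False by simp
      qed
      hence "{a \<in> norm_sphere l. ?R a w} = {}" by (auto simp: norm_sphere_def)
      thus ?thesis using True by simp
    next
      case False
      hence "{a \<in> norm_sphere l. ?R a w} = {a. qnorm a = l \<and> int_dvd l (qcnj a * w)}"
        using conj_dvd_square_iff[OF l _ w(1) _ False] w(2) by (auto simp: norm_sphere_def)
      thus ?thesis using card_left_divisors[OF l _ False] w(2) False by simp
    qed
  qed
  also have "\<dots> = 8 * card {w \<in> ?W. \<not> int_dvd l w}"
    by (simp add: sum.If_cases Int_def)
  finally have "card (norm_sphere l) * card (pure_sphere n) = 8 * card {w \<in> ?W. \<not> int_dvd l w}" .
  moreover have "card ?W = card {w \<in> ?W. int_dvd l w} + card {w \<in> ?W. \<not> int_dvd l w}"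
    by (subst card_Un_disjoint [symmetric]) (auto intro!: arg_cong[of _ _ card])
  ultimately show ?thesis using card_norm_sphere_int_dvd(2)[OF l0, of n] by simp
qed

section \<open>The number of quaternions of prime norm\<close>

lemma exists_sum_two_squares_plus_one:
  fixes l :: int
  assumes l: "prime l" "odd l"
  shows "\<exists>x y. l dvd 1 + x ^ 2 + y ^ 2"
proof -
  define h where "h = (l - 1) div 2"
  have l1: "l > 1" using l(1) prime_gt_1_int by blast
  have h: "l = 2 * h + 1" "h \<ge> 0" using l(2) l1 by (auto simp: h_def elim!: oddE)
  \<comment> \<open>Pigeonhole: x^2 and -1 - y^2 each take h + 1 values modulo l on {0..h}, together
    l + 1, so they share one.\<close>
  define f where "f = (\<lambda>x. x ^ 2 mod l)"
  define g where "g = (\<lambda>y. (- 1 - y ^ 2) mod l)"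
  have sq_inj: "x = y" if "x \<in> {0..h}" "y \<in> {0..h}" "l dvd x ^ 2 - y ^ 2" for x y
  proof -
    have "l dvd (x - y) * (x + y)"
      using that(3) by (simp add: power2_eq_square algebra_simps)
    hence "l dvd x - y \<or> l dvd x + y"
      using l(1) by (simp add: prime_dvd_mult_iff)
    moreover have "\<bar>x - y\<bar> < l" "\<bar>x + y\<bar> < l"
      using that h by auto
    ultimately have "x - y = 0 \<or> x + y = 0"
      using dvd_imp_le_int[of "x - y" l] dvd_imp_le_int[of "x + y" l] l1 by fastforce
    thus ?thesis using that by auto
  qed
  have "inj_on f {0..h}"
  proof (rule inj_onI)
    fix x y assume *: "x \<in> {0..h}" "y \<in> {0..h}" "f x = f y"
    hence "l dvd x ^ 2 - y ^ 2" by (simp add: f_def mod_eq_dvd_iff)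
    thus "x = y" using sq_inj * by blast
  qed
  hence cf: "card (f ` {0..h}) = nat (h + 1)" by (simp add: card_image)
  have "inj_on g {0..h}"
  proof (rule inj_onI)
    fix x y assume *: "x \<in> {0..h}" "y \<in> {0..h}" "g x = g y"
    hence "l dvd y ^ 2 - x ^ 2" by (simp add: g_def mod_eq_dvd_iff)
    thus "x = y" using sq_inj[of y x] * by simp
  qed
  hence cg: "card (g ` {0..h}) = nat (h + 1)" by (simp add: card_image)
  have sub: "f ` {0..h} \<union> g ` {0..h} \<subseteq> {0..<l}"
    using l1 by (auto simp: f_def g_def)
  have "f ` {0..h} \<inter> g ` {0..h} \<noteq> {}"
  proof
    assume "f ` {0..h} \<inter> g ` {0..h} = {}"
    hence "card (f ` {0..h} \<union> g ` {0..h}) = nat (h + 1) + nat (h + 1)"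
      using cf cg by (simp add: card_Un_disjoint)
    moreover have "card (f ` {0..h} \<union> g ` {0..h}) \<le> card {0..<l}"
      using sub by (intro card_mono) auto
    ultimately show False using h by simp
  qed
  then obtain x y where "f x = g y" by blast
  hence "l dvd x ^ 2 - (- 1 - y ^ 2)" by (simp only: f_def g_def mod_eq_dvd_iff)
  thus ?thesis by (intro exI[of _ x] exI[of _ y]) (simp add: algebra_simps)
qed

text \<open>An invertible coefficient lets its variable be solved for in terms of the other, which
  is free.\<close>

lemma card_linear_congruence:
  fixes l u v :: int
  assumes l: "prime l" and uv: "\<not> l dvd u \<or> \<not> l dvd v"
  shows "card {p \<in> {0..<l} \<times> {0..<l}. l dvd fst p * u + snd p * v} = nat l"
proof -
  have l0: "l > 0" using l prime_gt_0_int by blast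
  have one: "card {p \<in> {0..<l} \<times> {0..<l}. l dvd fst p * u + snd p * v} = nat l"
    if u: "\<not> l dvd u" for u v
  proof -
    have "coprime u l"
      using prime_imp_coprime[OF l u] by (simp add: coprime_commute)
    then obtain r where r: "[u * r = 1] (mod l)"
      using cong_solve_coprime_int by blast
    define s where "s = (\<lambda>t. (- t * v * r) mod l)"
    have "l dvd x * u + t * v \<longleftrightarrow> x = s t" if x: "x \<in> {0..<l}" for x t
    proof
      assume "l dvd x * u + t * v"
      hence "[x * u + t * v = 0] (mod l)" by (simp add: cong_0_iff)
      hence "[(x * u + t * v) * r - t * v * r = 0 * r - t * v * r] (mod l)"
        by (intro cong_diff cong_mult cong_refl)
      hence "[x * (u * r) = - t * v * r] (mod l)" by (simp add: algebra_simps)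
      moreover have "[x * (u * r) = x * 1] (mod l)" by (intro cong_mult cong_refl r)
      ultimately have "[x = - t * v * r] (mod l)"
        by (metis cong_sym cong_trans mult.right_neutral)
      thus "x = s t" using x by (simp add: s_def cong_def)
    next
      assume "x = s t"
      hence "[x = - t * v * r] (mod l)" by (simp add: s_def cong_def)
      hence "[x * u + t * v = (- t * v * r) * u + t * v] (mod l)"
        by (intro cong_add cong_mult cong_refl)
      also have "(- t * v * r) * u + t * v = - t * v * (u * r) + t * v" by (simp add: algebra_simps)
      also have "[- t * v * (u * r) + t * v = - t * v * 1 + t * v] (mod l)"
        by (intro cong_add cong_mult cong_refl r)
      finally show "l dvd x * u + t * v" by (simp add: cong_0_iff)
    qed
    hence "{p \<in> {0..<l} \<times> {0..<l}. l dvd fst p * u + snd p * v} = (\<lambda>t. (s t, t)) ` {0..<l}"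
      using l0 by (auto simp: s_def)
    moreover have "inj_on (\<lambda>t. (s t, t)) {0..<l}" by (auto simp: inj_on_def)
    ultimately show ?thesis by (simp add: card_image)
  qed
  show ?thesis
  proof (cases "l dvd u")
    case False thus ?thesis by (rule one)
  next
    case True
    have "{p \<in> {0..<l} \<times> {0..<l}. l dvd fst p * u + snd p * v}
      = prod.swap ` {p \<in> {0..<l} \<times> {0..<l}. l dvd fst p * v + snd p * u}"
      by (auto simp: add.commute image_iff)
    moreover have "inj_on prod.swap A" for A :: "(int \<times> int) set" by (auto simp: inj_on_def)
    ultimately show ?thesis using one[of v u] uv True by (simp add: card_image)
  qed
qed

text \<open>Modulo \<open>l\<close>, a product of matrices \<open>a * x * m\<close> with \<open>a\<close> and \<open>m\<close> of rank one depends on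
  \<open>x\<close> only up to a scalar.\<close>

lemma rank_one_proportional:
  assumes "l dvd qnorm a" "l dvd qnorm m"
  shows "int_dvd l (of_int (2 * qa (a * x * m * z)) * (a * y * m)
    - of_int (2 * qa (a * y * m * z)) * (a * x * m))"
proof -
  \<comment> \<open>The product a x m z a y m is evaluated twice: by the sandwich identity for a
    around x m z, and for m around z a y.\<close>
  have "a * x * m * z * (a * y * m) = (a * (x * m * z) * a) * (y * m)"
    by (simp only: mult.assoc)
  also have "\<dots> = of_int (2 * qa (a * x * m * z)) * (a * y * m)
      - of_int (qnorm a) * (qcnj (x * m * z) * (y * m))"
    by (simp only: quat_sandwich left_diff_distrib mult.assoc)
  finally have 1: "a * x * m * z * (a * y * m) = \<dots>" .
  have pull: "a * x * of_int k * q = of_int k * (a * x * q)" for k q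
    by (subst of_int_commute[of k "a * x", symmetric]) (rule mult.assoc)
  have tr: "qa (m * (z * a * y)) = qa (a * y * m * z)"
    using qa_mult_commute[of "m * z" "a * y"] by (simp only: mult.assoc)
  have "a * x * m * z * (a * y * m) = (a * x) * (m * (z * a * y) * m)"
    by (simp only: mult.assoc)
  also have "\<dots> = a * x * of_int (2 * qa (a * y * m * z)) * m
      - a * x * of_int (qnorm m) * qcnj (z * a * y)"
    by (simp only: quat_sandwich tr right_diff_distrib) (simp only: mult.assoc)
  also have "\<dots> = of_int (2 * qa (a * y * m * z)) * (a * x * m)
      - of_int (qnorm m) * (a * x * qcnj (z * a * y))"
    by (simp only: pull)
  finally have 2: "a * x * m * z * (a * y * m) = \<dots>" .
  have cancel: "p - q = r - s" if "t = p - r" "t = q - s" for p q r s t :: quat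
    using that by (auto simp: diff_eq_eq eq_diff_eq algebra_simps)
  have "of_int (2 * qa (a * x * m * z)) * (a * y * m) - of_int (2 * qa (a * y * m * z)) * (a * x * m)
    = of_int (qnorm a) * (qcnj (x * m * z) * (y * m)) - of_int (qnorm m) * (a * x * qcnj (z * a * y))"
    by (rule cancel[OF 1 2])
  thus ?thesis using assms by (simp only: int_dvd_diff int_dvd_of_int_mult)
qed

text \<open>\<open>qcnj a\<close> sends (s + t i) m to s y1 + t y2. As y1 and y2 are proportional
  and not both zero modulo l, its vanishing modulo l is one nontrivial linear congruence in (s, t),
  whose coefficients are the traces u and v.\<close>

lemma card_isotropic_line:
  assumes l: "prime l" "odd l" and a: "qnorm a = l" and xy: "l dvd 1 + x ^ 2 + y ^ 2"
  shows "card {p \<in> {0..<l} \<times> {0..<l}. int_dvd l (qcnj a * (Quat (fst p) (snd p) 0 0 * Quat 1 0 x y))} = nat l"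
proof -
  define m where "m = Quat 1 0 x y"
  define i where "i = Quat 0 1 0 0"
  define y1 where "y1 = qcnj a * 1 * m"
  define y2 where "y2 = qcnj a * i * m"
  have l1: "l > 1" using l(1) prime_gt_1_int by blast
  have na: "\<not> int_dvd l a" by (rule not_int_dvd_if_qnorm_eq[OF a l1])
  have nm: "l dvd qnorm m" using xy by (simp add: m_def qnorm_def)
  have w: "qcnj a * (Quat s t 0 0 * Quat 1 0 x y) = of_int s * y1 + of_int t * y2" for s t
    by (simp add: y1_def y2_def m_def i_def quat_eq_iff quat_sel_mult algebra_simps)
  have "\<not> int_dvd l y1 \<or> \<not> int_dvd l y2"
  proof (rule ccontr)
    assume "\<not> ?thesis"
    \<comment> \<open>Since i anticommutes with j and k, i m + m i = 2 i; this combination isolates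
      twice \<open>qcnj a\<close>.\<close>
    hence "int_dvd l ((y2 + y1 * i) * - i)"
      by (intro int_dvd_mult_right int_dvd_add) auto
    also have "(y2 + y1 * i) * - i = of_int 2 * qcnj a"
      by (simp add: y1_def y2_def m_def i_def quat_eq_iff quat_sel_mult)
    finally have "l dvd 2"
      using na prime_int_dvd_of_int_mult_iff[OF l(1), of 2 "qcnj a"] by simp
    hence "l = 2" using zdvd_imp_le[of l 2] l1 by linarith
    thus False using l(2) by simp
  qed
  then obtain z where z: "\<not> l dvd 2 * qa (y1 * z) \<or> \<not> l dvd 2 * qa (y2 * z)"
    using trace_not_dvd[OF l(2,1)] by metis
  define u where "u = 2 * qa (y1 * z)"
  define v where "v = 2 * qa (y2 * z)"
  have y12: "int_dvd l (of_int u * y2 - of_int v * y1)"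
    using rank_one_proportional[of l "qcnj a" m 1 z i] a nm by (simp add: u_def v_def y1_def y2_def)
  have "int_dvd l (of_int s * y1 + of_int t * y2) \<longleftrightarrow> l dvd s * u + t * v" for s t
  proof
    assume "int_dvd l (of_int s * y1 + of_int t * y2)"
    hence "int_dvd l ((of_int s * y1 + of_int t * y2) * z)" by (rule int_dvd_mult_right)
    hence "l dvd 2 * qa ((of_int s * y1 + of_int t * y2) * z)" by (simp add: int_dvd_def)
    also have "2 * qa ((of_int s * y1 + of_int t * y2) * z) = s * u + t * v"
      by (simp add: u_def v_def quat_sel_mult algebra_simps)
    finally show "l dvd s * u + t * v" .
  next
    assume d: "l dvd s * u + t * v"
    have "of_int u * (of_int s * y1 + of_int t * y2)
      = of_int (s * u + t * v) * y1 + of_int t * (of_int u * y2 - of_int v * y1)"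
      "of_int v * (of_int s * y1 + of_int t * y2)
      = of_int (s * u + t * v) * y2 - of_int s * (of_int u * y2 - of_int v * y1)"
      by (simp_all add: quat_eq_iff quat_sel_mult algebra_simps)
    hence "int_dvd l (of_int u * (of_int s * y1 + of_int t * y2))"
      "int_dvd l (of_int v * (of_int s * y1 + of_int t * y2))"
      using int_dvd_of_int_mult[OF d] int_dvd_mult_left[OF y12]
      by (simp_all only: int_dvd_add int_dvd_diff)
    thus "int_dvd l (of_int s * y1 + of_int t * y2)"
      using z prime_int_dvd_of_int_mult_iff[OF l(1)]
      unfolding u_def [symmetric] v_def [symmetric] by blast
  qed
  hence "{p \<in> {0..<l} \<times> {0..<l}. int_dvd l (qcnj a * (Quat (fst p) (snd p) 0 0 * Quat 1 0 x y))}
      = {p \<in> {0..<l} \<times> {0..<l}. l dvd fst p * u + snd p * v}"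
    by (simp add: w)
  thus ?thesis using card_linear_congruence[OF l(1)] z by (simp add: u_def v_def)
qed

text \<open>Count pairs of a of norm l and nonzero (s, t) modulo l with a a left divisor of (s + t
  i)(1 + x j + y k). Each a occurs with l - 1 pairs (s, t), each (s, t) with eight a, so r_4(l) (l -
  1) = 8 (l^2 - 1).\<close>

lemma card_norm_sphere_prime:
  assumes l: "prime l" "odd l"
  shows "int (card (norm_sphere l)) = 8 * (l + 1)"
proof -
  have l1: "l > 1" using l(1) prime_gt_1_int by blast
  obtain x y where xy: "l dvd 1 + x ^ 2 + y ^ 2"
    using exists_sum_two_squares_plus_one[OF l] by blast
  define w where "w = (\<lambda>p. Quat (fst p) (snd p) 0 0 * Quat 1 0 x y)"
  define T where "T = {0..<l} \<times> {0..<l} - {(0, 0)}"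
  have fin: "finite T" by (simp add: T_def)
  have line: "card {p \<in> T. int_dvd l (qcnj a * w p)} = nat l - 1" if "a \<in> norm_sphere l" for a
  proof -
    have a: "qnorm a = l" using that by (simp add: norm_sphere_def)
    have "{p \<in> T. int_dvd l (qcnj a * w p)} =
        {p \<in> {0..<l} \<times> {0..<l}. int_dvd l (qcnj a * w p)} - {(0, 0)}"
      by (auto simp: T_def)
    moreover have "w (0, 0) = 0" by (simp add: w_def quat_eq_iff quat_sel_mult)
    hence "(0, 0) \<in> {p \<in> {0..<l} \<times> {0..<l}. int_dvd l (qcnj a * w p)}" using l1 by simp
    moreover have "card {p \<in> {0..<l} \<times> {0..<l}. int_dvd l (qcnj a * w p)} = nat l"
      unfolding w_def by (rule card_isotropic_line[OF l a xy])
    ultimately show ?thesis by (simp only: card_Diff_singleton)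
  qed
  have div: "card {a \<in> norm_sphere l. int_dvd l (qcnj a * w p)} = 8" if "p \<in> T" for p
  proof -
    have "\<not> l dvd fst p \<or> \<not> l dvd snd p"
      using that zdvd_imp_le[of l "fst p"] zdvd_imp_le[of l "snd p"] by (force simp: T_def)
    \<comment> \<open>The first two coordinates of \<open>w p\<close> are those of p.\<close>
    hence "\<not> int_dvd l (w p)" by (auto simp: int_dvd_def w_def quat_sel_mult)
    moreover have "l dvd qnorm (w p)"
      using xy unfolding w_def qnorm_mult by (intro dvd_mult) (simp add: qnorm_def)
    ultimately show ?thesis using card_left_divisors[OF l] by (simp add: norm_sphere_def)
  qed
  have "card (norm_sphere l) * (nat l - 1) = (\<Sum>a\<in>norm_sphere l. card {p \<in> T. int_dvd l (qcnj a * w p)})"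
    using line by simp
  also have "\<dots> = (\<Sum>p\<in>T. card {a \<in> norm_sphere l. int_dvd l (qcnj a * w p)})"
    by (rule card_swap_pairs) (simp_all add: fin)
  also have "\<dots> = card T * 8" using div by simp
  also have "card T = nat l * nat l - 1"
    using l1 by (simp add: T_def card_Diff_singleton)
  finally have "int (card (norm_sphere l) * (nat l - 1)) = int ((nat l * nat l - 1) * 8)" by simp
  moreover have "nat l * nat l \<ge> 1" using l1 by (simp add: Suc_le_eq)
  ultimately have "int (card (norm_sphere l)) * (l - 1) = (l * l - 1) * 8"
    using l1 by (simp add: of_nat_diff)
  hence "(l - 1) * int (card (norm_sphere l)) = (l - 1) * (8 * (l + 1))"
    by (simp add: algebra_simps)
  thus ?thesis using l1 by simp
qed

section \<open>The recursions for sums of four and three squares\<close>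

lemma card_norm_sphere_5_mult_cong: "[card (norm_sphere (5 * n)) = card (norm_sphere n)] (mod 5)"
proof -
  have p5: "prime (5 :: int)" "odd (5 :: int)" by simp_all
  let ?W = "norm_sphere (5 * n)"
  have r5: "card (norm_sphere 5) = 48" using card_norm_sphere_prime[OF p5] by simp
  have split: "card ?W = card {w \<in> ?W. int_dvd 5 w} + card {w \<in> ?W. \<not> int_dvd 5 w}"
    by (subst card_Un_disjoint [symmetric]) (auto intro!: arg_cong[of _ _ card])
  \<comment> \<open>With D the multiples of 5 in W, 48 r_4(n) = 8 (|W| - |D|) + 48 |D|. Hence 6
    r_4(n) = |W| + 5 |D|, and 6 is 1 modulo 5.\<close>
  have "48 * card (norm_sphere n) = 8 * card {w \<in> ?W. \<not> int_dvd 5 w} + 48 * card {w \<in> ?W. int_dvd 5 w}"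
    using card_norm_sphere_prime_mult[OF p5, of n] by (simp only: r5)
  with split have "6 * card (norm_sphere n) = card ?W + 5 * card {w \<in> ?W. int_dvd 5 w}"
    by linarith
  moreover have "[b = a] (mod 5)" if "6 * a = b + 5 * c" for a b c :: nat
  proof -
    have "b mod 5 = (b + 5 * c) mod 5" by simp
    also have "b + 5 * c = a + 5 * a" using that by simp
    also have "\<dots> mod 5 = a mod 5" by (rule mod_mult_self2)
    finally show ?thesis by (simp add: cong_def)
  qed
  ultimately show ?thesis by blast
qed

lemma card_pure_sphere_prime_square_mult:
  assumes l: "prime l" "odd l" and n: "\<not> QuadRes l (- n)"
  shows "int (card (pure_sphere (l ^ 2 * n))) = (l + 2) * int (card (pure_sphere n))"
proof -
  have "int (card (norm_sphere l) * card (pure_sphere n) + 8 * card (pure_sphere n))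
    = int (8 * card (pure_sphere (l ^ 2 * n)))"
    by (simp only: card_pure_sphere_square_mult[OF assms])
  thus ?thesis using card_norm_sphere_prime[OF l] by (simp add: algebra_simps)
qed

text \<open>Squares are 0 or 1 modulo 4 according to parity, so three squares with sum divisible by
  4 are all even.\<close>

lemma card_pure_sphere_4_mult: "card (pure_sphere (4 * n)) = card (pure_sphere n)"
proof -
  have "int_dvd 2 w" if w: "w \<in> pure_sphere (4 * n)" for w
  proof -
    have eq: "qa w = 0" "qb w ^ 2 + qc w ^ 2 + qd w ^ 2 = 4 * n"
      using w by (auto simp: pure_sphere_def qnorm_def)
    have sq: "\<exists>k. even x \<and> x ^ 2 = 4 * k \<or> odd x \<and> x ^ 2 = 4 * k + 1" for x :: int
    proof (cases "even x")
      case True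
      then obtain k where "x = 2 * k" by (elim evenE)
      thus ?thesis by (intro exI[of _ "k * k"]) (simp add: power2_eq_square)
    next
      case False
      then obtain k where "x = 2 * k + 1" by (elim oddE)
      thus ?thesis by (intro exI[of _ "k * k + k"]) (simp add: power2_eq_square algebra_simps)
    qed
    obtain i j k where
      "even (qb w) \<and> qb w ^ 2 = 4 * i \<or> odd (qb w) \<and> qb w ^ 2 = 4 * i + 1"
      "even (qc w) \<and> qc w ^ 2 = 4 * j \<or> odd (qc w) \<and> qc w ^ 2 = 4 * j + 1"
      "even (qd w) \<and> qd w ^ 2 = 4 * k \<or> odd (qd w) \<and> qd w ^ 2 = 4 * k + 1"
      using sq by metis
    moreover have "4 * i + 4 * j + 4 * k + 1 \<noteq> 4 * n" "4 * i + 4 * j + 4 * k + 2 \<noteq> 4 * n"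
      "4 * i + 4 * j + 4 * k + 3 \<noteq> 4 * n" by presburger+
    ultimately have "even (qb w) \<and> even (qc w) \<and> even (qd w)"
      using eq(2) by (elim disjE conjE) simp_all
    thus ?thesis using eq(1) by (simp add: int_dvd_def)
  qed
  hence "{w \<in> pure_sphere (2 ^ 2 * n). int_dvd 2 w} = pure_sphere (4 * n)" by auto
  thus ?thesis using card_norm_sphere_int_dvd(2)[of 2 n] by simp
qed

section \<open>Reduction modulo 5\<close>

text \<open>The sign depends on the degree only and splits as (-1)^i (-1)^(n-i), so the counts are
  convolved as without signs. Finite fibres ensure that \<open>card\<close> really counts.\<close>

lemma theta_mult:
  assumes "\<And>n. finite {x. u x = n}" "\<And>n. finite {y. v y = n}"
  shows "theta u * theta v = theta (\<lambda>(x, y). u x + v y)"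
proof (rule fps_ext)
  fix n
  have "{p. (\<lambda>(x, y). u x + v y) p = n} = (\<Union>i\<in>{0..n}. {x. u x = i} \<times> {y. v y = n - i})"
    by auto
  also have "card \<dots> = (\<Sum>i=0..n. card ({x. u x = i} \<times> {y. v y = n - i}))"
    by (intro card_UN_disjoint) (auto simp: assms)
  also have "\<dots> = (\<Sum>i=0..n. card {x. u x = i} * card {y. v y = n - i})"
    by (simp add: card_cartesian_product)
  finally have c: "card {p. (\<lambda>(x, y). u x + v y) p = n} = \<dots>" .
  have "fps_nth (theta u * theta v) n
      = (\<Sum>i=0..n. ((- 1) ^ i * int (card {x. u x = i})) * ((- 1) ^ (n - i) * int (card {y. v y = n - i})))"
    by (simp add: fps_mult_nth theta_def)
  also have "\<dots> = (\<Sum>i=0..n. (- 1) ^ n * int (card {x. u x = i} * card {y. v y = n - i}))"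
  proof (intro sum.cong refl)
    fix i assume "i \<in> {0..n}"
    hence sign: "(- 1) ^ i * (- 1) ^ (n - i) = ((- 1) ^ n :: int)"
      by (simp flip: power_add)
    show "((- 1) ^ i * int (card {x. u x = i})) * ((- 1) ^ (n - i) * int (card {y. v y = n - i}))
        = (- 1) ^ n * int (card {x. u x = i} * card {y. v y = n - i})"
      unfolding sign [symmetric] of_nat_mult by (simp only: mult_ac)
  qed
  also have "\<dots> = fps_nth (theta (\<lambda>(x, y). u x + v y)) n"
    by (simp only: theta_def fps_nth_Abs_fps c of_nat_sum sum_distrib_left)
  finally show "fps_nth (theta u * theta v) n = fps_nth (theta (\<lambda>(x, y). u x + v y)) n" .
qed

lemma finite_add_fibers:
  assumes "\<And>n. finite {x. u x = n}" "\<And>n. finite {y. v y = (n :: nat)}"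
  shows "finite {p. (\<lambda>(x, y). u x + v y) p = (n :: nat)}"
proof (rule finite_subset)
  show "{p. (\<lambda>(x, y). u x + v y) p = n} \<subseteq> (\<Union>i\<in>{0..n}. {x. u x = i} \<times> {y. v y = n - i})"
    by auto
  show "finite (\<Union>i\<in>{0..n}. {x. u x = i} \<times> {y. v y = n - i})"
    using assms by simp
qed

lemma finite_int_square: "finite {x. int_square x = n}"
proof (rule finite_subset)
  show "{x. int_square x = n} \<subseteq> {- int n..int n}"
  proof
    fix x assume "x \<in> {x. int_square x = n}"
    moreover have "nat \<bar>x\<bar> \<le> nat \<bar>x\<bar> ^ 2" by (auto simp: power2_eq_square Suc_le_eq)
    ultimately have "nat \<bar>x\<bar> \<le> n" by simp
    thus "x \<in> {- int n..int n}" by auto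
  qed
qed simp

lemma theta_int_square_3: "fps_nth (theta int_square ^ 3) n = (- 1) ^ n * int (card (pure_sphere (int n)))"
  and theta_int_square_4: "fps_nth (theta int_square ^ 4) n = (- 1) ^ n * int (card (norm_sphere (int n)))"
proof -
  let ?s2 = "\<lambda>(x, y). int_square x + int_square y"
  let ?s3 = "\<lambda>(x, y). int_square x + ?s2 y"
  let ?s4 = "\<lambda>(x, y). int_square x + ?s3 y"
  note fin = finite_int_square
  note fin2 = finite_add_fibers[OF fin fin]
  note fin3 = finite_add_fibers[OF fin fin2]
  have t2: "theta int_square * theta int_square = theta ?s2"
    by (rule theta_mult[OF fin fin])
  have t3: "theta int_square * theta ?s2 = theta ?s3"
    by (rule theta_mult[OF fin fin2])
  have t4: "theta int_square * theta ?s3 = theta ?s4"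
    by (rule theta_mult[OF fin fin3])
  have "bij_betw (\<lambda>(x, y, z). Quat 0 x y z) {p. ?s3 p = n} (pure_sphere (int n))"
  proof (rule bij_betwI[where g = "\<lambda>q. (qb q, qc q, qd q)"])
    show "(\<lambda>(x, y, z). Quat 0 x y z) \<in> {p. ?s3 p = n} \<rightarrow> pure_sphere (int n)"
      by (auto simp: pure_sphere_def qnorm_def)
    show "(\<lambda>q. (qb q, qc q, qd q)) \<in> pure_sphere (int n) \<rightarrow> {p. ?s3 p = n}"
    proof
      fix q assume "q \<in> pure_sphere (int n)"
      hence "int (?s3 (qb q, qc q, qd q)) = int n"
        by (auto simp: pure_sphere_def qnorm_def)
      thus "(qb q, qc q, qd q) \<in> {p. ?s3 p = n}" by (simp only: of_nat_eq_iff mem_Collect_eq)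
    qed
  qed (auto simp: pure_sphere_def quat_eq_iff)
  hence "card {p. ?s3 p = n} = card (pure_sphere (int n))" by (rule bij_betw_same_card)
  moreover have "theta int_square ^ 3 = theta ?s3"
    by (simp only: power3_eq_cube t2 mult.commute[of "theta ?s2"] t3)
  ultimately show "fps_nth (theta int_square ^ 3) n = (- 1) ^ n * int (card (pure_sphere (int n)))"
    by (simp only: theta_def fps_nth_Abs_fps)
  have "bij_betw (\<lambda>(w, x, y, z). Quat w x y z) {p. ?s4 p = n} (norm_sphere (int n))"
  proof (rule bij_betwI[where g = "\<lambda>q. (qa q, qb q, qc q, qd q)"])
    show "(\<lambda>(w, x, y, z). Quat w x y z) \<in> {p. ?s4 p = n} \<rightarrow> norm_sphere (int n)"
      by (auto simp: norm_sphere_def qnorm_def)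
    show "(\<lambda>q. (qa q, qb q, qc q, qd q)) \<in> norm_sphere (int n) \<rightarrow> {p. ?s4 p = n}"
    proof
      fix q assume "q \<in> norm_sphere (int n)"
      hence "int (?s4 (qa q, qb q, qc q, qd q)) = int n"
        by (simp add: norm_sphere_def qnorm_def)
      thus "(qa q, qb q, qc q, qd q) \<in> {p. ?s4 p = n}" by (simp only: of_nat_eq_iff mem_Collect_eq)
    qed
  qed (auto simp: quat_eq_iff)
  hence "card {p. ?s4 p = n} = card (norm_sphere (int n))" by (rule bij_betw_same_card)
  moreover have "theta int_square ^ 4 = theta ?s4"
  proof -
    have "a ^ 4 = a * (a * (a * a))" for a :: "int fps" by (simp add: eval_nat_numeral)
    thus ?thesis by (simp only: t2 t3 t4)
  qed
  ultimately show "fps_nth (theta int_square ^ 4) n = (- 1) ^ n * int (card (norm_sphere (int n)))"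
    by (simp only: theta_def fps_nth_Abs_fps)
qed

section \<open>Fifth powers of power series modulo 5\<close>

lemma fps_numeral_dvd_iff:
  "(numeral k :: int fps) dvd f \<longleftrightarrow> (\<forall>n. numeral k dvd fps_nth f n)"
proof
  assume "numeral k dvd f"
  then obtain g where "f = numeral k * g" by (elim dvdE)
  hence "f = fps_const (numeral k) * g" by (simp add: numeral_fps_const)
  thus "\<forall>n. numeral k dvd fps_nth f n" by simp
next
  assume "\<forall>n. numeral k dvd fps_nth f n"
  hence "f = fps_const (numeral k) * Abs_fps (\<lambda>n. fps_nth f n div numeral k)"
    by (intro fps_ext) simp
  thus "numeral k dvd f" by (metis dvd_triv_left numeral_fps_const)
qed

text \<open>The inner binomial coefficients 5 and 10 are multiples of 5.\<close>

lemma power5_sum_dvd: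
  fixes f :: "'b \<Rightarrow> 'a::comm_ring_1"
  assumes "finite A"
  shows "5 dvd (\<Sum>x\<in>A. f x) ^ 5 - (\<Sum>x\<in>A. f x ^ 5)"
  using assms
proof (induction A)
  case (insert x A)
  have binom: "(a + b) ^ 5 - (a ^ 5 + c) = (b ^ 5 - c) + 5 * (a ^ 4 * b + 2 * a ^ 3 * b ^ 2 + 2 * a ^ 2 * b ^ 3 + a * b ^ 4)"
    for a b c :: 'a
    by (simp add: power_numeral_reduce algebra_simps)
  show ?case
    unfolding sum.insert[OF insert.hyps] binom by (intro dvd_add insert.IH dvd_triv_left)
qed simp

text \<open>Modulo 5, c^5 - c is the product of the five consecutive integers from c - 2 to c +
  2.\<close>

lemma power5_minus_self_dvd: "5 dvd c ^ 5 - (c :: int)"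
proof -
  have "c ^ 5 - c = (c - 2) * (c - 1) * c * (c + 1) * (c + 2) + 5 * (c ^ 3 - c)"
    by (simp add: power_numeral_reduce algebra_simps)
  moreover have "5 dvd c - 2 \<or> 5 dvd c - 1 \<or> 5 dvd c \<or> 5 dvd c + 1 \<or> 5 dvd c + 2"
    by presburger
  hence "5 dvd (c - 2) * (c - 1) * c * (c + 1) * (c + 2)" by (elim disjE) (simp_all add: dvd_mult dvd_mult2)
  ultimately show ?thesis by (metis dvd_add dvd_triv_left)
qed

text \<open>The substitution f(q^m).\<close>

definition spread :: "nat \<Rightarrow> 'a::zero fps \<Rightarrow> 'a fps" where
  "spread m f = Abs_fps (\<lambda>n. if m dvd n then fps_nth f (n div m) else 0)"

lemma agree_upto_power:
  fixes f g :: "'a::comm_semiring_1 fps"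
  shows "agree_upto N f g \<Longrightarrow> agree_upto N (f ^ m) (g ^ m)"
  by (induction m) (simp_all add: agree_upto_mult)

text \<open>Up to degree n, f is a finite sum of monomials, whose fifth power is the sum of their
  fifth powers modulo 5; Fermat's little theorem restores the coefficients.\<close>

lemma fps_power5_cong_spread: "(5 :: int fps) dvd f ^ 5 - spread 5 f"
  unfolding fps_numeral_dvd_iff
proof
  fix n
  define c where "c = fps_nth f"
  define m where "m = (\<lambda>i. fps_const (c i) * fps_X ^ i :: int fps)"
  define g where "g = (\<Sum>i\<in>{0..n}. m i)"
  have m_nth: "fps_nth (m i) j = (if j = i then c i else 0)" for i j
    by (simp add: m_def fps_X_power_nth)
  have m5: "fps_nth (m i ^ 5) n = (if n = 5 * i then c i ^ 5 else 0)" for i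
    by (simp add: m_def power_mult_distrib fps_const_power fps_X_power_nth mult.commute flip: power_mult)
  have "agree_upto n f g"
    by (simp add: agree_upto_def g_def fps_sum_nth m_nth c_def)
  hence "agree_upto n (f ^ 5) (g ^ 5)" by (rule agree_upto_power)
  hence f5: "fps_nth (f ^ 5) n = fps_nth (g ^ 5) n" by (simp add: agree_upto_def)
  have "(5 :: int fps) dvd g ^ 5 - (\<Sum>i\<in>{0..n}. m i ^ 5)"
    unfolding g_def by (rule power5_sum_dvd) simp
  hence 1: "5 dvd fps_nth (f ^ 5) n - (\<Sum>i\<in>{0..n}. fps_nth (m i ^ 5) n)"
    by (simp add: fps_numeral_dvd_iff f5 fps_sum_nth)
  have "(\<Sum>i\<in>{0..n}. fps_nth (m i ^ 5) n) = (if 5 dvd n then c (n div 5) ^ 5 else 0)"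
  proof (cases "5 dvd n")
    case True
    then obtain d where d: "n = 5 * d" by (elim dvdE)
    have "(\<Sum>i\<in>{0..n}. fps_nth (m i ^ 5) n) = (\<Sum>i\<in>{0..n}. if d = i then c i ^ 5 else 0)"
      by (intro sum.cong refl) (simp add: d m5[unfolded d])
    also have "\<dots> = c d ^ 5" using d by (simp add: sum.delta')
    finally show ?thesis using d by simp
  next
    case False
    hence "n \<noteq> 5 * i" for i by auto
    thus ?thesis using False by (simp add: m5)
  qed
  hence 2: "5 dvd (\<Sum>i\<in>{0..n}. fps_nth (m i ^ 5) n) - fps_nth (spread 5 f) n"
    using power5_minus_self_dvd by (simp add: spread_def c_def)
  show "5 dvd fps_nth (f ^ 5 - spread 5 f) n"
    using dvd_add[OF 1 2] by simp
qed

text \<open>Extracting exponents divisible by m commutes with multiplication by g(q^m), in which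
  only such exponents occur.\<close>

lemma fps_mult_spread_nth:
  fixes f g :: "int fps"
  assumes "m > 0"
  shows "fps_nth (f * spread m g) (m * n) = fps_nth (Abs_fps (\<lambda>i. fps_nth f (m * i)) * g) n"
proof -
  have "fps_nth (spread m g * f) (m * n) = (\<Sum>i=0..m * n. fps_nth (spread m g) i * fps_nth f (m * n - i))"
    by (rule fps_mult_nth)
  also have "\<dots> = (\<Sum>i\<in>(\<lambda>j. m * j) ` {0..n}. fps_nth (spread m g) i * fps_nth f (m * n - i))"
  proof (rule sum.mono_neutral_right)
    show "\<forall>i\<in>{0..m * n} - (\<lambda>j. m * j) ` {0..n}. fps_nth (spread m g) i * fps_nth f (m * n - i) = 0"
      using assms by (auto simp: spread_def elim!: dvdE)
  qed (use assms in auto)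
  also have "\<dots> = (\<Sum>j=0..n. fps_nth (spread m g) (m * j) * fps_nth f (m * n - m * j))"
    using assms by (subst sum.reindex) (auto simp: inj_on_def)
  also have "\<dots> = (\<Sum>j=0..n. fps_nth g j * fps_nth f (m * (n - j)))"
    using assms by (simp add: spread_def diff_mult_distrib2)
  also have "\<dots> = fps_nth (g * Abs_fps (\<lambda>i. fps_nth f (m * i))) n"
    by (simp add: fps_mult_nth)
  finally show ?thesis by (simp only: mult.commute)
qed

lemma overpartition_5_cong:
  "[overpartition_count (5 * n) = (- 1) ^ n * int (card (pure_sphere (int n)))] (mod 5)"
proof -
  let ?T = "theta int_square"
  let ?P = overpart_fps
  define U where "U = Abs_fps (\<lambda>n. fps_nth ?P (5 * n))"
  have "?P * ?T ^ 5 = (?P * ?T) * ?T ^ 4" by (simp add: power_numeral_reduce mult_ac)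
  hence PT: "?P * ?T ^ 5 = ?T ^ 4" by (simp only: overpart_fps_theta mult_1)
  have "(5 :: int fps) dvd ?P * (?T ^ 5 - spread 5 ?T)"
    by (intro dvd_mult fps_power5_cong_spread)
  hence 1: "(5 :: int fps) dvd ?T ^ 4 - ?P * spread 5 ?T"
    by (simp only: right_diff_distrib PT)
  have "5 dvd fps_nth (?T ^ 4 - U * ?T) n" for n
  proof -
    have "5 dvd fps_nth (?T ^ 4) (5 * n) - fps_nth (?P * spread 5 ?T) (5 * n)"
      using 1 unfolding fps_numeral_dvd_iff by (simp only: fps_sub_nth)
    hence a: "[fps_nth (?T ^ 4) (5 * n) = fps_nth (U * ?T) n] (mod 5)"
      unfolding U_def by (simp only: fps_mult_spread_nth[OF zero_less_numeral] cong_iff_dvd_diff)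
    have "[int (card (norm_sphere (5 * int n))) = int (card (norm_sphere (int n)))] (mod 5)"
      using card_norm_sphere_5_mult_cong[of "int n"] by (metis cong_int_iff of_nat_numeral)
    hence "[(- 1) ^ n * int (card (norm_sphere (5 * int n))) = (- 1) ^ n * int (card (norm_sphere (int n)))] (mod 5)"
      by (intro cong_mult cong_refl)
    \<comment> \<open>The sign survives the passage from 5n to n because 5 is odd.\<close>
    moreover have "(- 1) ^ (5 * n) = ((- 1) ^ n :: int)" by (simp add: power_mult)
    ultimately have b: "[fps_nth (?T ^ 4) (5 * n) = fps_nth (?T ^ 4) n] (mod 5)"
      by (simp only: theta_int_square_4 of_nat_mult of_nat_numeral)
    have "[fps_nth (?T ^ 4) n = fps_nth (U * ?T) n] (mod 5)"
      by (rule cong_trans[OF cong_sym[OF b] a])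
    thus ?thesis by (simp only: cong_iff_dvd_diff fps_sub_nth)
  qed
  \<comment> \<open>Multiplying by P, the inverse of theta, cancels one factor theta on both sides
    and leaves theta^3 against U.\<close>
  hence "(5 :: int fps) dvd ?P * (?T ^ 4 - U * ?T)"
    by (intro dvd_mult) (simp add: fps_numeral_dvd_iff)
  also have "?P * (?T ^ 4 - U * ?T) = (?P * ?T) * (?T ^ 3 - U)"
    by (simp add: power_numeral_reduce algebra_simps)
  finally have "(5 :: int fps) dvd ?T ^ 3 - U" by (simp only: overpart_fps_theta mult_1)
  hence "5 dvd fps_nth (?T ^ 3) n - fps_nth U n"
    by (simp only: fps_numeral_dvd_iff fps_sub_nth)
  hence "[fps_nth U n = fps_nth (?T ^ 3) n] (mod 5)"
    by (simp only: cong_iff_dvd_diff dvd_diff_commute)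
  thus ?thesis
    by (simp only: theta_int_square_3 U_def overpart_fps_def fps_nth_Abs_fps)
qed

lemma card_pure_sphere_power_4_mult: "card (pure_sphere (4 ^ k * n)) = card (pure_sphere n)"
  by (induction k) (simp_all add: mult.assoc card_pure_sphere_4_mult)

theorem theorem1p4:
  fixes k n :: nat and l :: int
  assumes "prime l" and "[l = 3] (mod 5)" and "Legendre (- int n) l = -1"
  shows "[overpartition_count (4 ^ k * 5 * nat l ^ 2 * n) = 0] (mod 5)"
proof -
  define m where "m = 4 ^ k * (nat l ^ 2 * n)"
  have l0: "l > 0" using assms(1) prime_gt_0_int by blast
  have "l \<noteq> 2" using assms(2) by (auto simp: cong_def)
  hence "odd l" using assms(1) prime_odd_int prime_ge_2_int by (metis order_le_less)
  moreover have "\<not> QuadRes l (- int n)"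
    using assms(3) by (auto simp: Legendre_def split: if_splits)
  ultimately have "int (card (pure_sphere (l ^ 2 * int n))) = (l + 2) * int (card (pure_sphere (int n)))"
    by (rule card_pure_sphere_prime_square_mult[OF assms(1)])
  moreover have "int m = 4 ^ k * (l ^ 2 * int n)"
    using l0 by (simp add: m_def)
  ultimately have r3: "int (card (pure_sphere (int m))) = (l + 2) * int (card (pure_sphere (int n)))"
    by (simp only: card_pure_sphere_power_4_mult)
  \<comment> \<open>The residue 3 makes the factor l + 2 of the r_3 recursion vanish modulo
    5.\<close>
  have "[l + 2 = 3 + 2] (mod 5)" using assms(2) by (intro cong_add cong_refl)
  hence "5 dvd l + 2" by (simp add: cong_def mod_eq_0_iff_dvd)
  hence "[(- 1) ^ m * int (card (pure_sphere (int m))) = 0] (mod 5)"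
    unfolding r3 cong_0_iff by (intro dvd_mult dvd_mult2)
  hence "[overpartition_count (5 * m) = 0] (mod 5)"
    by (rule cong_trans[OF overpartition_5_cong])
  moreover have "4 ^ k * 5 * nat l ^ 2 * n = 5 * m" by (simp add: m_def)
  ultimately show ?thesis by (simp only:)
qed

end
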